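(* Let $\lambda>0$ and let $\{X_n:n\geq 1\}$ be i.i.d. random variables with exponential distribution of rate $\lambda$, i.e. with common distribution function $F(t)=1-e^{-\lambda t}$ for $t\geq 0$. Let $w:[0,1]\to\mathbb{R}$ be a continuous function for which there exist $x_0\in(0,1)$ and $c>0$ such that $|w(x)|\leq c(1-x)$ for all $x\in[1-x_0,1]$, and set $h_w(x):=\frac{w(x)}{1-x}$ for $x\in[0,1)$. Let $\Lambda_w:\mathbb{R}\to\mathbb{R}\cup\{\infty\}$ be defined by $$\Lambda_w(\theta):=\begin{cases}\displaystyle\int_0^1\log\left(\frac{\lambda}{\lambda-\theta h_w(x)}\right)dx & \text{if } \sup_{x\in[0,1)}\{\theta h_w(x)\}\leq\lambda,\\ \infty & \text{otherwise.}\end{cases}$$ Assume that $\Lambda_w$ is finite in a neighbourhood of $\theta=0$, and that $\Lambda_w$ is essentially smooth and lower semi-continuous. For $n\geq 1$ let $$C_n(w):=\sum_{k=0}^{n-1}w(k/n)\,(X_{k+1:n}-X_{k:n}),$$ where $X_{1:n}\leq\cdots\leq X_{n:n}$ are the ascending order statistics of $X_1,\ldots,X_n$ and $X_{0:n}:=0$. Then the sequence $\{C_n(w):n\geq 1\}$ satisfies the large deviation principle on $\mathbb{R}$ with speed function $v_n=n$ and good rate function $\Lambda_w^*$ defined by $$\Lambda_w^*(y):=\sup_{\theta\in\mathbb{R}}\{\theta y-\Lambda_w(\theta)\}.$$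
   Context: Large deviation principle: a sequence of real random variables $\{Z_n:n\geq1\}$ satisfies the large deviation principle (LDP) with speed function $v_n$ and rate function $I$ if $\lim_{n\to\infty}v_n=\infty$; $I:\mathbb{R}\to[0,\infty]$ is lower semi-continuous; $\limsup_{n\to\infty}\frac{1}{v_n}\log P(Z_n\in C)\leq-\inf_{x\in C}I(x)$ for all closed sets $C\subseteq\mathbb{R}$; and $\liminf_{n\to\infty}\frac{1}{v_n}\log P(Z_n\in O)\geq-\inf_{x\in O}I(x)$ for all open sets $O\subseteq\mathbb{R}$. The rate function $I$ is good if its level sets $\{x\in\mathbb{R}:I(x)\leq\eta\}$, $\eta\geq 0$, are compact. Essential smoothness: for $\Lambda:\mathbb{R}\to\mathbb{R}\cup\{\infty\}$ let $\mathcal{D}(\Lambda):=\{\theta\in\mathbb{R}:\Lambda(\theta)<\infty\}$. The function $\Lambda$ is essentially smooth if the interior of $\mathcal{D}(\Lambda)$ is non-empty, $\Lambda$ is differentiable throughout the interior of $\mathcal{D}(\Lambda)$, and $|\Lambda'(\theta_n)|\to\infty$ whenever $\{\theta_n\}$ is a sequence of points in the interior of $\mathcal{D}(\Lambda)$ converging to a boundary point of $\mathcal{D}(\Lambda)$. In the definition of $\Lambda_w$ the integrand is taken to be $+\infty$ at points $x$ where $\theta h_w(x)=\lambda$; the integral may equal $+\infty$. *)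

theory Defs
  imports "HOL-Probability.Probability"
begin

text \<open>Values in \<open>\<real> \<union> {\<infinity>}\<close> and \<open>[0,\<infinity>]\<close> are represented in \<^typ>\<open>ereal\<close>.\<close>

definition lower_semicontinuous :: "(real \<Rightarrow> ereal) \<Rightarrow> bool" where
  "lower_semicontinuous f \<longleftrightarrow> (\<forall>x. f x \<le> Liminf (at x) f)"

text \<open>Logarithm of a probability, with \<open>log 0 = -\<infinity>\<close>.\<close>

definition log_prob :: "real \<Rightarrow> ereal" where
  "log_prob p = (if p > 0 then ereal (ln p) else -\<infinity>)"

text \<open>Sequences are indexed by \<open>n \<ge> 1\<close>; the index 0 plays no role. Note that
  \<open>INF x\<in>{}. I x = \<infinity>\<close> in \<^typ>\<open>ereal\<close>.\<close>

definition LDP ::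
  "'a measure \<Rightarrow> (nat \<Rightarrow> 'a \<Rightarrow> real) \<Rightarrow> (nat \<Rightarrow> real) \<Rightarrow> (real \<Rightarrow> ereal) \<Rightarrow> bool" where
  "LDP M Z v I \<longleftrightarrow>
     (\<forall>n\<ge>1. Z n \<in> borel_measurable M) \<and>
     filterlim v at_top sequentially \<and>
     (\<forall>x. 0 \<le> I x) \<and> lower_semicontinuous I \<and>
     (\<forall>C. closed C \<longrightarrow>
        limsup (\<lambda>n. ereal (1 / v n) * log_prob (measure M {\<omega> \<in> space M. Z n \<omega> \<in> C}))
          \<le> - (INF x\<in>C. I x)) \<and>
     (\<forall>U. open U \<longrightarrow>
        liminf (\<lambda>n. ereal (1 / v n) * log_prob (measure M {\<omega> \<in> space M. Z n \<omega> \<in> U}))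
          \<ge> - (INF x\<in>U. I x))"

definition good_rate :: "(real \<Rightarrow> ereal) \<Rightarrow> bool" where
  "good_rate I \<longleftrightarrow> (\<forall>\<eta>\<ge>0. compact {x. I x \<le> ereal \<eta>})"

definition eff_domain :: "(real \<Rightarrow> ereal) \<Rightarrow> real set" where
  "eff_domain L = {\<theta>. L \<theta> < \<infinity>}"

text \<open>For \<open>L\<close> with values in \<open>\<real> \<union> {\<infinity>}\<close>: on the interior of its effective domain \<open>L\<close> is
  finite, so its derivative there is that of \<open>\<lambda>t. real_of_ereal (L t)\<close>.\<close>

definition essentially_smooth :: "(real \<Rightarrow> ereal) \<Rightarrow> bool" where
  "essentially_smooth L \<longleftrightarrow>
     interior (eff_domain L) \<noteq> {} \<and>
     (\<forall>\<theta> \<in> interior (eff_domain L). (\<lambda>t. real_of_ereal (L t)) differentiable (at \<theta>)) \<and>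
     (\<forall>s b. (\<forall>n. s n \<in> interior (eff_domain L)) \<and> b \<in> frontier (eff_domain L) \<and>
        s \<longlonglongrightarrow> b \<longrightarrow>
        filterlim (\<lambda>n. \<bar>deriv (\<lambda>t. real_of_ereal (L t)) (s n)\<bar>) at_top sequentially)"

definition legendre_transform :: "(real \<Rightarrow> ereal) \<Rightarrow> real \<Rightarrow> ereal" where
  "legendre_transform L y = (SUP \<theta>. ereal (\<theta> * y) - L \<theta>)"

text \<open>Lebesgue integral of an extended-real function as the integral of its positive part minus
  that of its negative part (\<^const>\<open>e2ennreal\<close> sends negative values to 0). It is used only where
  the integral of the negative part is finite.\<close>

definition ereal_integral :: "real set \<Rightarrow> (real \<Rightarrow> ereal) \<Rightarrow> ereal" where
  "ereal_integral S f =
     enn2ereal (\<integral>\<^sup>+ x\<in>S. e2ennreal (f x) \<partial>lborel) -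
     enn2ereal (\<integral>\<^sup>+ x\<in>S. e2ennreal (- f x) \<partial>lborel)"

definition h_fun :: "(real \<Rightarrow> real) \<Rightarrow> real \<Rightarrow> real" where
  "h_fun w x = w x / (1 - x)"

text \<open>The relevant \<open>h_fun w\<close> are bounded on \<open>[0,1)\<close>, so the integrand is bounded below and
  \<open>Lambda lam w \<theta> > -\<infinity>\<close>. The single point 1 is omitted from the domain of integration.\<close>

definition Lambda :: "real \<Rightarrow> (real \<Rightarrow> real) \<Rightarrow> real \<Rightarrow> ereal" where
  "Lambda lam w \<theta> =
     (if (SUP x\<in>{0..<1}. ereal (\<theta> * h_fun w x)) \<le> ereal lam
      then ereal_integral {0..<1}
             (\<lambda>x. if \<theta> * h_fun w x = lam then \<infinity> else ereal (ln (lam / (lam - \<theta> * h_fun w x))))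
      else \<infinity>)"

text \<open>\<open>order_stat X n k\<close> is the \<open>k\<close>-th smallest of \<open>X 1, \<dots>, X n\<close> for \<open>1 \<le> k \<le> n\<close>, and 0 for
  \<open>k = 0\<close>.\<close>

definition order_stat :: "(nat \<Rightarrow> 'a \<Rightarrow> real) \<Rightarrow> nat \<Rightarrow> nat \<Rightarrow> 'a \<Rightarrow> real" where
  "order_stat X n k \<omega> = (if k = 0 then 0 else sort (map (\<lambda>i. X i \<omega>) [1..<Suc n]) ! (k - 1))"

definition C_stat :: "(real \<Rightarrow> real) \<Rightarrow> (nat \<Rightarrow> 'a \<Rightarrow> real) \<Rightarrow> nat \<Rightarrow> 'a \<Rightarrow> real" where
  "C_stat w X n \<omega> =
     (\<Sum>k<n. w (real k / real n) * (order_stat X n (k + 1) \<omega> - order_stat X n k \<omega>))"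

end

theory Submission
  imports Defs
begin

text \<open>The moment generating function of \<open>C_n(w)\<close> factorizes as
  \<open>E exp(n \<theta> C_n(w)) = \<Prod>\<^sub>k \<lambda> / (\<lambda> - \<theta> h_w(k/n))\<close>, because the spacings of an exponential sample are
  independent exponentials of rates \<open>(n - k) \<lambda>\<close>; integrating out the sample minimum and using that
  the remaining sample is again exponential beyond it gives this by induction. Hence the normalized
  cumulants are Riemann sums that converge to \<open>\<Lambda>\<^sub>w(\<theta>)\<close> whenever \<open>\<theta> h_w\<close> is bounded away from \<open>\<lambda>\<close>,
  which describes exactly the interior of the effective domain. At boundary points the cumulants need
  not converge, but neither bound of the Gaertner-Ellis argument needs them: the Legendre transform is
  already the supremum over interior \<open>\<theta>\<close>, and by steepness every point where it is finite is a limit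
  of slopes \<open>\<Lambda>\<^sub>w'(\<theta>)\<close> with \<open>\<theta>\<close> interior whose rates do not exceed the rate of the point.\<close>

section \<open>Spacings of exponential samples\<close>

text \<open>The sort hidden in \<open>order_stat\<close> has no product structure, so the sample is
  split according to which index carries the minimum. Removing that index leaves an arbitrary finite
  index set, a random starting level and weights shifted by one; \<open>gap_sum\<close>,
  \<open>sorted_values\<close> and \<open>bounded_below_on\<close> are general in exactly these
  directions so that the induction closes.

  Cumulants can fail at a boundary point \<theta> because a single grid point with
  \<open>\<theta> * h_fun w (k / n) = lam\<close> makes the moment generating function infinite for
  that n, while the integral may still be finite.

  Steepness enters through a dichotomy: if y lies beyond all slopes, then the interior of the domain
  contains a whole half-line, since slopes would be unbounded near a finite end; far out on that
  half-line a finite rate at y forces the slopes up to y. The lower bound near an attained slope is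
  proved with unnormalized integrals of \<open>exp (n * \<theta> * Z n)\<close>, so no tilted
  probability measure is constructed.\<close>

fun gap_sum :: "(nat \<Rightarrow> real) \<Rightarrow> real \<Rightarrow> real list \<Rightarrow> real" where
  "gap_sum c s [] = 0"
| "gap_sum c s (y # ys) = c 0 * (y - s) + gap_sum (\<lambda>k. c (Suc k)) y ys"

lemma gap_sum_eq_sum:
  "gap_sum c s ys = (\<Sum>k<length ys. c k * (ys ! k - (if k = 0 then s else ys ! (k - 1))))"
proof (induction ys arbitrary: c s)
  case (Cons y ys)
  have "(\<Sum>k<length (y # ys). c k * ((y # ys) ! k - (if k = 0 then s else (y # ys) ! (k - 1))))
    = c 0 * (y - s) + (\<Sum>k<length ys. c (Suc k) * (ys ! k - (y # ys) ! k))"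
    by (simp add: sum.lessThan_Suc_shift del: sum.lessThan_Suc)
  also have "(\<Sum>k<length ys. c (Suc k) * (ys ! k - (y # ys) ! k))
    = (\<Sum>k<length ys. c (Suc k) * (ys ! k - (if k = 0 then y else ys ! (k - 1))))"
    by (intro sum.cong) (auto simp: nth_Cons')
  finally show ?case
    by (simp add: Cons.IH del: sum.lessThan_Suc)
qed simp

lemma gap_sum_scale: "gap_sum (\<lambda>k. a * c k) s ys = a * gap_sum c s ys"
  by (induction ys arbitrary: c s) (simp_all add: distrib_left)

section \<open>Sorted samples and the index of the minimum\<close>

definition sorted_values :: "nat set \<Rightarrow> (nat \<Rightarrow> real) \<Rightarrow> real list" where
  "sorted_values I x = sorted_list_of_multiset (image_mset x (mset_set I))"

text \<open>Strict bounds on \<open>J\<close> break ties in favour of the smallest index, so that the events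
  \<open>first_argmin\<close> below partition the sample space exactly.\<close>

definition bounded_below_on :: "nat set \<Rightarrow> real \<Rightarrow> nat set \<Rightarrow> (nat \<Rightarrow> real) \<Rightarrow> bool" where
  "bounded_below_on J s I x \<longleftrightarrow> (\<forall>i\<in>I. if i \<in> J then s < x i else s \<le> x i)"

lemma bounded_below_on_cong:
  "(\<And>i. i \<in> I \<Longrightarrow> x i = y i) \<Longrightarrow> bounded_below_on J s I x \<longleftrightarrow> bounded_below_on J s I y"
  by (simp add: bounded_below_on_def)

abbreviation first_argmin :: "nat set \<Rightarrow> (nat \<Rightarrow> real) \<Rightarrow> nat \<Rightarrow> bool" where
  "first_argmin I x i \<equiv> bounded_below_on {..<i} (x i) (I - {i}) x"

lemma first_argmin_unique:
  assumes "i \<in> I" "j \<in> I" "first_argmin I x i" "first_argmin I x j"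
  shows "i = j"
proof (rule ccontr)
  assume "i \<noteq> j"
  then have "if j < i then x i < x j else x i \<le> x j" "if i < j then x j < x i else x j \<le> x i"
    using assms by (auto simp: bounded_below_on_def)
  then show False
    using \<open>i \<noteq> j\<close> by (auto split: if_splits)
qed

lemma first_argmin_exists:
  assumes "finite I" "I \<noteq> {}"
  obtains i where "i \<in> I" "first_argmin I x i"
proof
  let ?m = "Min (x ` I)"
  let ?S = "{i \<in> I. x i = ?m}"
  have "?m \<in> x ` I"
    using assms by (intro Min_in) auto
  then have "?S \<noteq> {}" by auto
  then have i: "Min ?S \<in> ?S"
    using assms(1) by (intro Min_in) auto
  then show "Min ?S \<in> I" by simp
  have le: "?m \<le> x j" if "j \<in> I" for j
    using assms that by simp
  have "Min ?S \<le> j" if "j \<in> I" "x j = ?m" for j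
    using assms that by (intro Min_le) auto
  then have lt: "?m < x j" if "j \<in> I" "j < Min ?S" for j
    using that le by (metis leD order_le_imp_less_or_eq)
  have xm: "x (Min ?S) = ?m"
    using i by simp
  show "first_argmin I x (Min ?S)"
    unfolding bounded_below_on_def xm using le lt by simp
qed

text \<open>Turns a quantity known only case by case, according to the position of the minimum, into
  one finite sum. This serves both measurability and the splitting of the integral.\<close>

lemma sum_first_argmin:
  fixes f :: "nat \<Rightarrow> 'b :: semiring_1"
  assumes "finite I" "i \<in> I" "first_argmin I x i"
  shows "(\<Sum>j\<in>I. of_bool (first_argmin I x j) * f j) = f i"
proof -
  have "(\<Sum>j\<in>I. of_bool (first_argmin I x j) * f j) = (\<Sum>j\<in>I. if j = i then f j else 0)"
  proof (rule sum.cong[OF refl])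
    fix j assume "j \<in> I"
    then have "first_argmin I x j \<longleftrightarrow> j = i"
      using first_argmin_unique assms(2,3) by blast
    then show "of_bool (first_argmin I x j) * f j = (if j = i then f j else 0)"
      by (simp only: of_bool_def) simp
  qed
  then show ?thesis
    using assms by simp
qed

lemma sorted_values_cong: "(\<And>i. i \<in> I \<Longrightarrow> x i = y i) \<Longrightarrow> sorted_values I x = sorted_values I y"
  unfolding sorted_values_def
  by (cases "finite I") (auto intro!: arg_cong[of _ _ sorted_list_of_multiset] image_mset_cong)

lemma sorted_values_first_argmin:
  assumes "finite I" "i \<in> I" "first_argmin I x i"
  shows "sorted_values I x = x i # sorted_values (I - {i}) x"
proof -
  have "mset_set I = add_mset i (mset_set (I - {i}))"
    using mset_set.remove[OF assms(1,2)] .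
  moreover have "\<forall>y\<in>set (sorted_values (I - {i}) x). x i \<le> y"
    using assms by (auto simp: sorted_values_def bounded_below_on_def split: if_splits intro: less_imp_le)
  ultimately show ?thesis
    by (simp add: sorted_values_def insort_is_Cons)
qed

lemma pred_bounded_below_on:
  assumes "finite I" "s \<in> borel_measurable N" "\<And>i. i \<in> I \<Longrightarrow> (\<lambda>\<omega>. X \<omega> i) \<in> borel_measurable N"
  shows "Measurable.pred N (\<lambda>\<omega>. bounded_below_on J (s \<omega>) I (X \<omega>))"
proof -
  have "Measurable.pred N (\<lambda>\<omega>. if i \<in> J then s \<omega> < X \<omega> i else s \<omega> \<le> X \<omega> i)" if "i \<in> I" for i
    using assms(2) assms(3)[OF that] by (cases "i \<in> J") simp_all
  then show ?thesis
    unfolding bounded_below_on_def using assms(1)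
    by (intro pred_intros_finite) auto
qed

text \<open>On each event \<open>first_argmin\<close> the sorted list has an explicit head, so the
  recursion of \<open>gap_sum\<close> applies. The starting level is a random variable here because
  the recursive call starts at the removed coordinate.\<close>

lemma measurable_gap_sum:
  assumes "finite I" "s \<in> borel_measurable N" "\<And>i. i \<in> I \<Longrightarrow> (\<lambda>\<omega>. X \<omega> i) \<in> borel_measurable N"
  shows "(\<lambda>\<omega>. gap_sum c (s \<omega>) (sorted_values I (X \<omega>))) \<in> borel_measurable N"
  using assms
proof (induction "card I" arbitrary: I c s)
  case 0
  then show ?case by (simp add: sorted_values_def)
next
  case (Suc n)
  let ?G = "\<lambda>i \<omega>. c 0 * (X \<omega> i - s \<omega>) + gap_sum (\<lambda>k. c (Suc k)) (X \<omega> i) (sorted_values (I - {i}) (X \<omega>))"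
  have "gap_sum c (s \<omega>) (sorted_values I (X \<omega>)) =
    (\<Sum>i\<in>I. of_bool (first_argmin I (X \<omega>) i) * ?G i \<omega>)" for \<omega>
  proof -
    obtain i where "i \<in> I" "first_argmin I (X \<omega>) i"
      using first_argmin_exists[of I "X \<omega>"] Suc by force
    then show ?thesis
      using Suc.prems sum_first_argmin[of I i "X \<omega>" "\<lambda>i. ?G i \<omega>"]
      by (simp add: sorted_values_first_argmin)
  qed
  moreover have "(\<lambda>\<omega>. of_bool (first_argmin I (X \<omega>) i) * ?G i \<omega>) \<in> borel_measurable N" if "i \<in> I" for i
  proof -
    have [measurable]: "s \<in> borel_measurable N" "(\<lambda>\<omega>. X \<omega> i) \<in> borel_measurable N"
      using Suc.prems that by auto
    have [measurable]: "(\<lambda>\<omega>. gap_sum (\<lambda>k. c (Suc k)) (X \<omega> i) (sorted_values (I - {i}) (X \<omega>))) \<in> borel_measurable N"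
      by (rule Suc.hyps(1)) (use Suc.hyps(2) Suc.prems that in auto)
    have [measurable]: "Measurable.pred N (\<lambda>\<omega>. first_argmin I (X \<omega>) i)"
      by (rule pred_bounded_below_on) (use Suc.prems that in auto)
    show ?thesis by measurable
  qed
  ultimately show ?case
    by simp
qed

section \<open>Moment generating function of weighted spacings\<close>

lemma nn_integral_exp_tail:
  assumes "a > 0"
  shows "(\<integral>\<^sup>+ t. ennreal (exp (- a * t)) * indicator {s..} t \<partial>lborel) = ennreal (exp (- a * s) / a)"
proof -
  have "(\<integral>\<^sup>+ t. ennreal (exp (- a * t)) * indicator {s..} t \<partial>lborel)
    = 0 - (- exp (- a * s) / a)"
  proof (rule nn_integral_FTC_atLeast)
    show "((\<lambda>t. - exp (- a * t) / a) \<longlongrightarrow> 0) at_top"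
    proof -
      have "filterlim (\<lambda>t. - a * t) at_bot at_top"
        using assms by (intro filterlim_tendsto_neg_mult_at_bot[OF tendsto_const _ filterlim_ident]) simp
      then have "((\<lambda>t. exp (- a * t)) \<longlongrightarrow> 0) at_top"
        by (rule filterlim_compose[OF exp_at_bot])
      then have "((\<lambda>t. - exp (- a * t) / a) \<longlongrightarrow> - 0 / a) at_top"
        using assms by (intro tendsto_intros) simp_all
      then show ?thesis by simp
    qed
  qed (use assms in \<open>auto intro!: derivative_eq_intros\<close>)
  then show ?thesis by simp
qed

context
  fixes lam :: real
  assumes lam: "lam > 0"
begin

abbreviation Exp where "Exp \<equiv> density lborel (\<lambda>x. ennreal (exponential_density lam x))"

interpretation Exp: prob_space Exp
  using prob_space_exponential_density[OF lam] .

interpretation product_sigma_finite "\<lambda>_::nat. Exp"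
  by standard

text \<open>Absence of atoms makes the strict and the weak bounds in \<open>bounded_below_on\<close>
  interchangeable under the integral.\<close>

lemma AE_Exp_neq: "AE t in Exp. t \<noteq> s"
  by (subst AE_density) (use AE_lborel_singleton[of s] in \<open>auto elim: eventually_mono\<close>)

lemma nn_integral_Exp_tail:
  assumes "s \<ge> 0" "a < lam"
  shows "(\<integral>\<^sup>+ t. ennreal (exp (a * t)) * indicator {s..} t \<partial>Exp) = ennreal (lam * exp ((a - lam) * s) / (lam - a))"
proof -
  have "(\<integral>\<^sup>+ t. ennreal (exp (a * t)) * indicator {s..} t \<partial>Exp)
    = (\<integral>\<^sup>+ t. ennreal lam * (ennreal (exp (- (lam - a) * t)) * indicator {s..} t) \<partial>lborel)"
  proof (subst nn_integral_density)
    show "(\<integral>\<^sup>+ t. ennreal (exponential_density lam t) * (ennreal (exp (a * t)) * indicator {s..} t) \<partial>lborel)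
      = (\<integral>\<^sup>+ t. ennreal lam * (ennreal (exp (- (lam - a) * t)) * indicator {s..} t) \<partial>lborel)"
    proof (rule nn_integral_cong)
      fix t
      show "ennreal (exponential_density lam t) * (ennreal (exp (a * t)) * indicator {s..} t)
        = ennreal lam * (ennreal (exp (- (lam - a) * t)) * indicator {s..} t)"
        using assms lam
        by (auto simp: indicator_def exponential_density_def ennreal_mult[symmetric] exp_add[symmetric]
            algebra_simps)
    qed
  qed auto
  also have "\<dots> = ennreal lam * ennreal (exp (- (lam - a) * s) / (lam - a))"
    using assms by (subst nn_integral_cmult) (auto simp only: nn_integral_exp_tail diff_gt_0_iff_gt, measurable)
  also have "\<dots> = ennreal (lam * exp ((a - lam) * s) / (lam - a))"
    using assms lam by (subst ennreal_mult[symmetric]) auto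
  finally show ?thesis .
qed

lemma measurable_PiM_Exp_component: "j \<in> I \<Longrightarrow> (\<lambda>x. x j) \<in> borel_measurable (Pi\<^sub>M I (\<lambda>_. Exp))"
  using measurable_component_singleton[of j I "\<lambda>_. Exp"]
  by (simp add: measurable_cong_sets[OF refl, of Exp borel])

lemma measurable_exp_gap_sum:
  assumes "finite I"
  shows "(\<lambda>x. ennreal (exp (gap_sum c s (sorted_values I x))) * of_bool (bounded_below_on J s I x))
    \<in> borel_measurable (Pi\<^sub>M I (\<lambda>_. Exp))"
proof -
  have [measurable]: "(\<lambda>x. gap_sum c s (sorted_values I x)) \<in> borel_measurable (Pi\<^sub>M I (\<lambda>_. Exp))"
    by (rule measurable_gap_sum) (use assms measurable_PiM_Exp_component in auto)
  have [measurable]: "Measurable.pred (Pi\<^sub>M I (\<lambda>_. Exp)) (\<lambda>x. bounded_below_on J s I x)"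
    by (rule pred_bounded_below_on) (use assms measurable_PiM_Exp_component in auto)
  show ?thesis by measurable
qed

lemma measurable_exp_gap_sum_argmin:
  assumes "finite I" "i \<in> I"
  shows "(\<lambda>x. of_bool (first_argmin I x i) *
      (ennreal (exp (gap_sum c s (sorted_values I x))) * of_bool (bounded_below_on J s I x)))
    \<in> borel_measurable (Pi\<^sub>M I (\<lambda>_. Exp))"
proof -
  note [measurable] = measurable_exp_gap_sum[OF assms(1)]
  have [measurable]: "Measurable.pred (Pi\<^sub>M I (\<lambda>_. Exp)) (\<lambda>x. first_argmin I x i)"
    by (rule pred_bounded_below_on) (use assms measurable_PiM_Exp_component in auto)
  show ?thesis by measurable
qed

text \<open>This is memorylessness: \<open>exp (- (n * lam * s))\<close> is the probability that all
  n points exceed s, and the product collects the transforms of the spacings beyond s, which are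
  exponential of rates \<open>(n - k) * lam\<close>. The set J is arbitrary because the induction
  hypothesis is used with \<open>{..<i}\<close>; ties have measure zero, so J does not affect the
  value.\<close>

lemma nn_integral_exp_gap_sum:
  assumes "finite I" "card I = n" "s \<ge> 0" "\<And>k. k < n \<Longrightarrow> c k < real (n - k) * lam"
  shows "(\<integral>\<^sup>+ x. ennreal (exp (gap_sum c s (sorted_values I x))) * of_bool (bounded_below_on J s I x)
      \<partial>(\<Pi>\<^sub>M i\<in>I. Exp))
    = ennreal (exp (- (real n * lam * s)) * (\<Prod>k<n. lam * real (n - k) / (real (n - k) * lam - c k)))"
  using assms
proof (induction n arbitrary: I s c J)
  case 0
  then show ?case
    by (simp add: sorted_values_def bounded_below_on_def PiM_empty nn_integral_count_space_finite)
next
  case (Suc n)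
  \<comment> \<open>P belongs to the n remaining points with shifted weights. A comes from
    integrating the minimum over \<open>{s..}\<close> when its index is fixed, and therefore lacks
    the factor \<open>Suc n\<close>.\<close>
  define P where "P = (\<Prod>k<n. lam * real (n - k) / (real (n - k) * lam - c (Suc k)))"
  define A where "A = lam * exp (- (real (Suc n) * lam * s)) / (real (Suc n) * lam - c 0)"
  have c0: "c 0 < real (Suc n) * lam"
    using Suc.prems(4)[of 0] by simp
  have cS: "c (Suc k) < real (n - k) * lam" if "k < n" for k
    using Suc.prems(4)[of "Suc k"] that by simp
  have P_nn: "P \<ge> 0"
    unfolding P_def using lam cS by (intro prod_nonneg) (auto intro!: divide_nonneg_nonneg less_imp_le)
  have A_nn: "A \<ge> 0"
    unfolding A_def using lam c0 by (intro divide_nonneg_nonneg) auto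
  let ?f = "\<lambda>x. ennreal (exp (gap_sum c s (sorted_values I x))) * of_bool (bounded_below_on J s I x)"
  let ?F = "\<lambda>i x. of_bool (first_argmin I x i) * ?f x"
  have part: "(\<integral>\<^sup>+ x. ?F i x \<partial>(\<Pi>\<^sub>M i\<in>I. Exp)) = ennreal (A * P)" if i: "i \<in> I" for i
  proof -
    let ?I = "I - {i}"
    have I: "insert i ?I = I" using i by auto
    let ?g = "\<lambda>t x. ennreal (exp (gap_sum (\<lambda>k. c (Suc k)) t (sorted_values ?I x)))
      * of_bool (bounded_below_on {..<i} t ?I x)"
    have F_meas: "?F i \<in> borel_measurable (Pi\<^sub>M (insert i ?I) (\<lambda>_. Exp))"
      unfolding I by (rule measurable_exp_gap_sum_argmin[OF Suc.prems(1) i])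
    have "(\<integral>\<^sup>+ x. ?F i x \<partial>(\<Pi>\<^sub>M i\<in>I. Exp)) = (\<integral>\<^sup>+ x. ?F i x \<partial>(\<Pi>\<^sub>M i\<in>insert i ?I. Exp))"
      by (simp only: I)
    also have "\<dots> = (\<integral>\<^sup>+ t. (\<integral>\<^sup>+ x. ?F i (x(i := t)) \<partial>(\<Pi>\<^sub>M i\<in>?I. Exp)) \<partial>Exp)"
      by (rule product_nn_integral_insert_rev[OF _ _ F_meas]) (use Suc.prems(1) in simp_all)
    \<comment> \<open>With the minimum fixed at t, the inner integral is the induction hypothesis
      with starting level t and tie-breaking set \<open>{..<i}\<close>. The value t = s is
      discarded, as the bound on J may be strict there.\<close>
    also have "\<dots> = (\<integral>\<^sup>+ t. ennreal (exp (- (c 0 * s)) * P) * (ennreal (exp ((c 0 - real n * lam) * t)) * indicator {s..} t) \<partial>Exp)"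
    proof (rule nn_integral_cong_AE, use AE_Exp_neq[of s] in eventually_elim)
      fix t assume "t \<noteq> s"
      have "?F i (x(i := t)) = ennreal (exp (c 0 * (t - s))) * of_bool (s \<le> t) * ?g t x" for x
      proof -
        have fa_iff: "first_argmin I (x(i := t)) i \<longleftrightarrow> bounded_below_on {..<i} t ?I x"
          unfolding fun_upd_same by (rule bounded_below_on_cong) simp
        show ?thesis
        proof (cases "bounded_below_on {..<i} t ?I x")
          case True
          then have fa: "first_argmin I (x(i := t)) i"
            using fa_iff by blast
          have "sorted_values ?I (x(i := t)) = sorted_values ?I x"
            by (rule sorted_values_cong) simp
          then have sv: "sorted_values I (x(i := t)) = t # sorted_values ?I x"
            unfolding sorted_values_first_argmin[OF Suc.prems(1) i fa] by (simp only: fun_upd_same)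
          \<comment> \<open>All other coordinates are at least t, so t alone decides the bound on
            all of I; \<open>t \<noteq> s\<close> bridges the weak and the strict case.\<close>
          have "bounded_below_on J s I (x(i := t)) \<longleftrightarrow> s \<le> t"
          proof
            assume "bounded_below_on J s I (x(i := t))"
            then show "s \<le> t"
              using i by (auto simp: bounded_below_on_def split: if_splits dest!: bspec[of _ _ i])
          next
            assume "s \<le> t"
            then have "s < t" using \<open>t \<noteq> s\<close> by simp
            have "t \<le> x j" if "j \<in> ?I" for j
              using True that by (auto simp: bounded_below_on_def split: if_splits intro: less_imp_le)
            then have "s < (x(i := t)) j" if "j \<in> I" for j
              using \<open>s < t\<close> that by (cases "j = i") (auto intro: less_le_trans)
            then show "bounded_below_on J s I (x(i := t))"
              by (auto simp: bounded_below_on_def simp del: fun_upd_apply intro: less_imp_le)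
          qed
          then show ?thesis
            using True fa by (simp add: sv exp_add ennreal_mult)
        next
          case False
          then have "\<not> first_argmin I (x(i := t)) i"
            using fa_iff by blast
          with False show ?thesis by (simp only: of_bool_eq) simp
        qed
      qed
      then have "(\<integral>\<^sup>+ x. ?F i (x(i := t)) \<partial>(\<Pi>\<^sub>M i\<in>?I. Exp))
        = (\<integral>\<^sup>+ x. ennreal (exp (c 0 * (t - s))) * of_bool (s \<le> t) * ?g t x \<partial>(\<Pi>\<^sub>M i\<in>?I. Exp))"
        by simp
      also have "\<dots> = ennreal (exp (c 0 * (t - s))) * of_bool (s \<le> t) * (\<integral>\<^sup>+ x. ?g t x \<partial>(\<Pi>\<^sub>M i\<in>?I. Exp))"
        by (intro nn_integral_cmult measurable_exp_gap_sum) (use Suc.prems(1) in simp)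
      also have "\<dots> = ennreal (exp (c 0 * (t - s))) * of_bool (s \<le> t) * ennreal (exp (- (real n * lam * t)) * P)"
      proof (cases "s \<le> t")
        case True
        have "(\<integral>\<^sup>+ x. ?g t x \<partial>(\<Pi>\<^sub>M i\<in>?I. Exp)) = ennreal (exp (- (real n * lam * t)) * P)"
          unfolding P_def by (rule Suc.IH) (use Suc.prems cS i True in auto)
        then show ?thesis by simp
      qed simp
      also have "\<dots> = ennreal (exp (- (c 0 * s)) * P) * (ennreal (exp ((c 0 - real n * lam) * t)) * indicator {s..} t)"
      proof (cases "s \<le> t")
        case True
        have "exp (c 0 * (t - s)) * exp (- (real n * lam * t)) = exp (- (c 0 * s)) * exp ((c 0 - real n * lam) * t)"
          unfolding exp_add[symmetric] by (rule arg_cong[of _ _ exp]) (simp add: algebra_simps)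
        then have "exp (c 0 * (t - s)) * (exp (- (real n * lam * t)) * P) = exp (- (c 0 * s)) * P * exp ((c 0 - real n * lam) * t)"
          by (metis mult.assoc mult.commute)
        moreover have "ennreal (exp (c 0 * (t - s))) * ennreal (exp (- (real n * lam * t)) * P)
          = ennreal (exp (c 0 * (t - s)) * (exp (- (real n * lam * t)) * P))"
          by (rule ennreal_mult[symmetric]) (use P_nn in auto)
        moreover have "ennreal (exp (- (c 0 * s)) * P * exp ((c 0 - real n * lam) * t))
          = ennreal (exp (- (c 0 * s)) * P) * ennreal (exp ((c 0 - real n * lam) * t))"
          by (rule ennreal_mult) (use P_nn in auto)
        ultimately have "ennreal (exp (c 0 * (t - s))) * ennreal (exp (- (real n * lam * t)) * P)
          = ennreal (exp (- (c 0 * s)) * P) * ennreal (exp ((c 0 - real n * lam) * t))"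
          by (simp only:)
        then show ?thesis
          using True by simp
      qed simp
      finally show "(\<integral>\<^sup>+ x. ?F i (x(i := t)) \<partial>(\<Pi>\<^sub>M i\<in>?I. Exp))
        = ennreal (exp (- (c 0 * s)) * P) * (ennreal (exp ((c 0 - real n * lam) * t)) * indicator {s..} t)" .
    qed
    also have "\<dots> = ennreal (exp (- (c 0 * s)) * P) *
        ennreal (lam * exp ((c 0 - real n * lam - lam) * s) / (lam - (c 0 - real n * lam)))"
    proof (subst nn_integral_cmult)
      have "c 0 - real n * lam < lam"
        using c0 by (simp add: algebra_simps)
      from nn_integral_Exp_tail[OF Suc.prems(3) this]
      show "ennreal (exp (- (c 0 * s)) * P) *
          (\<integral>\<^sup>+ t. ennreal (exp ((c 0 - real n * lam) * t)) * indicator {s..} t \<partial>Exp)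
        = ennreal (exp (- (c 0 * s)) * P) *
          ennreal (lam * exp ((c 0 - real n * lam - lam) * s) / (lam - (c 0 - real n * lam)))"
        by (simp only:)
    qed simp
    also have "\<dots> = ennreal (A * P)"
    proof -
      have "exp (- (c 0 * s)) * exp ((c 0 - real n * lam - lam) * s) = exp (- (real (Suc n) * lam * s))"
        by (simp add: exp_add[symmetric] algebra_simps)
      moreover have "lam - (c 0 - real n * lam) = real (Suc n) * lam - c 0"
        by (simp add: algebra_simps)
      moreover have "x * P * (lam * y / d) = lam * (x * y) / d * P" for x y d
        by simp
      ultimately have "exp (- (c 0 * s)) * P * (lam * exp ((c 0 - real n * lam - lam) * s) / (lam - (c 0 - real n * lam)))
        = A * P"
        unfolding A_def by (simp only:)
      moreover have "0 \<le> lam * exp ((c 0 - real n * lam - lam) * s) / (lam - (c 0 - real n * lam))"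
        using lam c0 by (intro divide_nonneg_nonneg) (auto simp: algebra_simps)
      moreover have "0 \<le> exp (- (c 0 * s)) * P"
        using P_nn by simp
      ultimately show ?thesis
        by (metis ennreal_mult)
    qed
    finally show ?thesis .
  qed
  have "?f x = (\<Sum>i\<in>I. ?F i x)" for x
  proof -
    obtain i where "i \<in> I" "first_argmin I x i"
      using first_argmin_exists[of I x] Suc.prems by force
    then show ?thesis
      using sum_first_argmin[of I i x "\<lambda>_. ?f x"] Suc.prems(1) by simp
  qed
  then have "(\<integral>\<^sup>+ x. ?f x \<partial>(\<Pi>\<^sub>M i\<in>I. Exp)) = (\<integral>\<^sup>+ x. (\<Sum>i\<in>I. ?F i x) \<partial>(\<Pi>\<^sub>M i\<in>I. Exp))"
    by (intro nn_integral_cong) simp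
  also have "\<dots> = (\<Sum>i\<in>I. \<integral>\<^sup>+ x. ?F i x \<partial>(\<Pi>\<^sub>M i\<in>I. Exp))"
    by (intro nn_integral_sum measurable_exp_gap_sum_argmin Suc.prems(1))
  \<comment> \<open>By symmetry every index contributes the same amount, and their number supplies
    the factor missing from A.\<close>
  also have "\<dots> = of_nat (Suc n) * ennreal (A * P)"
    using part Suc.prems(2) by simp
  also have "\<dots> = ennreal (real (Suc n) * (A * P))"
    using A_nn P_nn by (subst ennreal_mult) (auto simp: ennreal_of_nat_eq_real_of_nat)
  also have "real (Suc n) * (A * P) = exp (- (real (Suc n) * lam * s)) *
      (\<Prod>k<Suc n. lam * real (Suc n - k) / (real (Suc n - k) * lam - c k))"
    unfolding A_def P_def by (subst prod.lessThan_Suc_shift) (simp add: mult_ac)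
  finally show ?case .
qed

end

lemma C_stat_eq_gap_sum:
  "C_stat w X n \<omega> = gap_sum (\<lambda>k. w (real k / real n)) 0 (sorted_values {1..n} (\<lambda>i. X i \<omega>))"
proof -
  let ?ys = "sort (map (\<lambda>i. X i \<omega>) [1..<Suc n])"
  have "{1..n} = {1..<Suc n}" by auto
  then have "mset (map (\<lambda>i. X i \<omega>) [1..<Suc n]) = image_mset (\<lambda>i. X i \<omega>) (mset_set {1..n})"
    by (simp only: mset_map mset_upt)
  then have ys: "sorted_values {1..n} (\<lambda>i. X i \<omega>) = ?ys"
    unfolding sorted_values_def by (metis sorted_list_of_multiset_mset)
  show ?thesis
    unfolding C_stat_def ys gap_sum_eq_sum order_stat_def
    by (intro sum.cong) simp_all
qed

text \<open>The weight of the k-th spacing is \<open>n * \<theta> * w (k / n) = (n - k) * (\<theta>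
  * h_fun w (k / n))\<close>, since \<open>n * (1 - k / n) = n - k\<close>. The factor
  \<open>n - k\<close> cancels against the rate \<open>(n - k) * lam\<close> of that spacing; this
  is where \<open>h_fun\<close> comes from.\<close>

lemma (in prob_space) mgf_C_stat:
  assumes lam: "0 < lam"
    and indep: "indep_vars (\<lambda>_. borel) X {1..}"
    and distr: "\<And>n. n \<ge> 1 \<Longrightarrow> distributed M lborel (X n) (exponential_density lam)"
    and n: "n \<ge> 1"
    and less: "\<And>k. k < n \<Longrightarrow> \<theta> * h_fun w (real k / real n) < lam"
  shows "(\<integral>\<^sup>+ \<omega>. ennreal (exp (real n * \<theta> * C_stat w X n \<omega>)) \<partial>M)
    = ennreal (\<Prod>k<n. lam / (lam - \<theta> * h_fun w (real k / real n)))"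
proof -
  let ?E = "density lborel (\<lambda>x. ennreal (exponential_density lam x))"
  let ?I = "{1..n}"
  let ?c = "\<lambda>k. real n * \<theta> * w (real k / real n)"
  have X [measurable]: "X i \<in> borel_measurable M" if "i \<in> ?I" for i
    using distr[of i] that by (auto dest: distributed_measurable)
  have dE: "distr M borel (X i) = ?E" if "i \<in> ?I" for i
    using distributed_distr_eq_density[OF distr, of i] that
    by (simp add: distr_cong[of M M borel lborel "X i" "X i"])
  have "indep_vars (\<lambda>_. borel) X ?I"
    by (rule indep_vars_subset[OF indep]) auto
  then have "distr M (\<Pi>\<^sub>M i\<in>?I. borel) (\<lambda>x. \<lambda>i\<in>?I. X i x) = (\<Pi>\<^sub>M i\<in>?I. distr M borel (X i))"
    by (subst (asm) indep_vars_iff_distr_eq_PiM') (use n X in auto)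
  also have "\<dots> = (\<Pi>\<^sub>M i\<in>?I. ?E)"
    by (rule PiM_cong) (use dE in auto)
  finally have D: "distr M (\<Pi>\<^sub>M i\<in>?I. borel) (\<lambda>x. \<lambda>i\<in>?I. X i x) = (\<Pi>\<^sub>M i\<in>?I. ?E)" .
  \<comment> \<open>The sample is almost surely nonnegative, so the indicator with starting level 0
    can be inserted into the integral without changing it.\<close>
  have AE: "AE \<omega> in M. bounded_below_on {} 0 ?I (\<lambda>i. X i \<omega>)"
  proof -
    have "AE \<omega> in M. 0 \<le> X i \<omega>" if "i \<in> ?I" for i
    proof (rule AE_distrD[OF X[OF that]])
      have "AE t in lborel. 0 < ennreal (exponential_density lam t) \<longrightarrow> 0 \<le> t"
        by (auto simp: exponential_density_def)
      then show "AE t in distr M borel (X i). 0 \<le> t"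
        unfolding dE[OF that] by (subst AE_density) auto
    qed
    then have "AE \<omega> in M. \<forall>i\<in>?I. 0 \<le> X i \<omega>"
      by (intro AE_finite_allI) auto
    then show ?thesis
      by (auto simp: bounded_below_on_def)
  qed
  let ?f = "\<lambda>x. ennreal (exp (gap_sum ?c 0 (sorted_values ?I x))) * of_bool (bounded_below_on {} 0 ?I x)"
  have comp [measurable]: "(\<lambda>x. x j) \<in> borel_measurable (\<Pi>\<^sub>M i\<in>?I. borel)" if "j \<in> ?I" for j
    using that by (rule measurable_component_singleton)
  have [measurable]: "(\<lambda>x. gap_sum ?c 0 (sorted_values ?I x)) \<in> borel_measurable (\<Pi>\<^sub>M i\<in>?I. borel)"
    using measurable_gap_sum[of ?I "\<lambda>_. 0" _ "\<lambda>x. x"] comp by simp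
  have [measurable]: "Measurable.pred (\<Pi>\<^sub>M i\<in>?I. borel) (\<lambda>x. bounded_below_on {} 0 ?I x)"
    using pred_bounded_below_on[of ?I "\<lambda>_. 0" _ "\<lambda>x. x"] comp by simp
  have "(\<integral>\<^sup>+ \<omega>. ennreal (exp (real n * \<theta> * C_stat w X n \<omega>)) \<partial>M) = (\<integral>\<^sup>+ \<omega>. ?f (\<lambda>i\<in>?I. X i \<omega>) \<partial>M)"
  proof (rule nn_integral_cong_AE, use AE in eventually_elim)
    fix \<omega> assume b: "bounded_below_on {} 0 ?I (\<lambda>i. X i \<omega>)"
    have "sorted_values ?I (\<lambda>i\<in>?I. X i \<omega>) = sorted_values ?I (\<lambda>i. X i \<omega>)"
      by (rule sorted_values_cong) simp
    moreover have "bounded_below_on {} 0 ?I (\<lambda>i\<in>?I. X i \<omega>)"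
      using b by (simp add: bounded_below_on_def)
    ultimately show "ennreal (exp (real n * \<theta> * C_stat w X n \<omega>)) = ?f (\<lambda>i\<in>?I. X i \<omega>)"
      by (simp add: C_stat_eq_gap_sum gap_sum_scale)
  qed
  also have "\<dots> = (\<integral>\<^sup>+ x. ?f x \<partial>distr M (\<Pi>\<^sub>M i\<in>?I. borel) (\<lambda>x. \<lambda>i\<in>?I. X i x))"
  proof (rule nn_integral_distr[symmetric])
    show "(\<lambda>x. \<lambda>i\<in>?I. X i x) \<in> measurable M (\<Pi>\<^sub>M i\<in>?I. borel)"
      by (rule measurable_restrict) (rule X)
    show "?f \<in> borel_measurable (distr M (\<Pi>\<^sub>M i\<in>?I. borel) (\<lambda>x. \<lambda>i\<in>?I. X i x))"
      by measurable
  qed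
  also have "\<dots> = ennreal (exp (- (real n * lam * 0)) *
      (\<Prod>k<n. lam * real (n - k) / (real (n - k) * lam - ?c k)))"
    unfolding D
  proof (rule nn_integral_exp_gap_sum[OF lam])
    fix k assume k: "k < n"
    then have "?c k = real (n - k) * (\<theta> * h_fun w (real k / real n))"
      by (simp add: h_fun_def of_nat_diff field_simps)
    also have "\<dots> < real (n - k) * lam"
      using less[OF k] k by (intro mult_strict_left_mono) auto
    finally show "?c k < real (n - k) * lam" .
  qed auto
  also have "(\<Prod>k<n. lam * real (n - k) / (real (n - k) * lam - ?c k))
    = (\<Prod>k<n. lam / (lam - \<theta> * h_fun w (real k / real n)))"
  proof (rule prod.cong[OF refl])
    fix k assume "k \<in> {..<n}"
    then have k: "k < n" by simp
    then have "?c k = real (n - k) * (\<theta> * h_fun w (real k / real n))"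
      by (simp add: h_fun_def of_nat_diff field_simps)
    then have "real (n - k) * lam - ?c k = real (n - k) * (lam - \<theta> * h_fun w (real k / real n))"
      by (simp add: right_diff_distrib)
    then show "lam * real (n - k) / (real (n - k) * lam - ?c k) = lam / (lam - \<theta> * h_fun w (real k / real n))"
      using k by simp
  qed
  finally show ?thesis by simp
qed

section \<open>Riemann sums and the limiting cumulant function\<close>

text \<open>The step function evaluates g at the left grid point of the cell of x, which makes its
  bound and its pointwise limit visible.\<close>

lemma riemann_step_function:
  fixes g :: "real \<Rightarrow> real"
  assumes "n \<ge> 1"
  shows "(\<Sum>k<n. indicator {real k / real n..<real (Suc k) / real n} x * g (real k / real n))
    = indicator {0..<1} x * g (real (nat \<lfloor>real n * x\<rfloor>) / real n)"
proof -
  have iff: "x \<in> {real k / real n..<real (Suc k) / real n} \<longleftrightarrow> real k \<le> real n * x \<and> real n * x < real k + 1" for k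
    using assms by (auto simp: field_simps)
  show ?thesis
  proof (cases "x \<in> {0..<1}")
    case True
    let ?k = "nat \<lfloor>real n * x\<rfloor>"
    have nx: "0 \<le> real n * x" "real n * x < real n"
      using True assms by auto
    have k: "real k \<le> real n * x \<and> real n * x < real k + 1 \<longleftrightarrow> k = ?k" for k
      using nx by linarith
    have "?k < n"
      using nx by linarith
    have "(\<Sum>k<n. indicator {real k / real n..<real (Suc k) / real n} x * g (real k / real n))
      = (\<Sum>k<n. if k = ?k then g (real k / real n) else 0)"
      by (intro sum.cong refl) (simp only: indicator_def iff k of_bool_def, simp)
    also have "\<dots> = g (real ?k / real n)"
      using \<open>?k < n\<close> by simp
    finally show ?thesis
      using True by simp
  next
    case False
    have "x \<notin> {real k / real n..<real (Suc k) / real n}" if "k < n" for k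
    proof
      assume "x \<in> {real k / real n..<real (Suc k) / real n}"
      then have k: "real k \<le> real n * x" "real n * x < real k + 1"
        using iff by auto
      have "0 \<le> real n * x" "real n * x < real n * 1"
        using k that by linarith+
      then show False
        using False assms by (simp add: zero_le_mult_iff)
    qed
    then show ?thesis
      using False by simp
  qed
qed

text \<open>The function g may have no limit at 1, so the sums are written as integrals of step
  functions and dominated convergence is applied with the constant B on
  \<open>{0..<1}\<close>.\<close>

lemma riemann_sums_tendsto:
  fixes g :: "real \<Rightarrow> real"
  assumes cont: "continuous_on {0..<1} g" and bound: "\<And>x. x \<in> {0..<1} \<Longrightarrow> \<bar>g x\<bar> \<le> B"
  shows "(\<lambda>n. (\<Sum>k<n. g (real k / real n)) / real n) \<longlonglongrightarrow> (LINT x:{0..<1}|lborel. g x)"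
proof -
  define s where "s n x = (\<Sum>k<n. indicator {real k / real n..<real (Suc k) / real n} x * g (real k / real n))" for n x
  have s_eq: "s n x = indicator {0..<1} x * g (real (nat \<lfloor>real n * x\<rfloor>) / real n)" if "n \<ge> 1" for n x
    unfolding s_def using that by (rule riemann_step_function)
  have mem: "real (nat \<lfloor>real n * x\<rfloor>) / real n \<in> {0..<1}" if "n \<ge> 1" "x \<in> {0..<1}" for n x
  proof -
    have "0 \<le> real n * x" "real n * x < real n"
      using that by simp_all
    then have "real (nat \<lfloor>real n * x\<rfloor>) < real n"
      by linarith
    then show ?thesis
      using that by (simp add: divide_less_eq)
  qed
  have "(\<lambda>n. integral\<^sup>L lborel (s n)) \<longlonglongrightarrow> (LINT x|lborel. indicator {0..<1} x *\<^sub>R g x)"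
  proof (rule integral_dominated_convergence[where w = "\<lambda>x::real. indicator {0..<1} x * B"])
    show "(\<lambda>x. indicator {0..<1} x *\<^sub>R g x) \<in> borel_measurable lborel"
      using borel_measurable_continuous_on_indicator[OF _ cont] by simp
    show "s n \<in> borel_measurable lborel" for n
      unfolding s_def by measurable
    show "integrable lborel (\<lambda>x::real. indicator {0..<1} x * B)"
      by (auto intro!: integrable_real_indicator)
    show "AE x in lborel. norm (s n x) \<le> indicator {0..<1} x * B" for n
    proof (cases "n \<ge> 1")
      case True
      show ?thesis
        using bound[OF mem[OF True]] by (auto simp: s_eq[OF True] indicator_def)
    next
      case False
      have "0 \<le> B" using bound[of 0] by simp
      with False show ?thesis by (simp add: s_def)
    qed
    have "(\<lambda>n. s n x) \<longlonglongrightarrow> indicator {0..<1} x *\<^sub>R g x" for x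
    proof (cases "x \<in> {0..<1}")
      case True
      let ?y = "\<lambda>n. real (nat \<lfloor>real n * x\<rfloor>) / real n"
      have "\<bar>?y n - x\<bar> \<le> 1 / real n" if n: "n \<ge> 1" for n
      proof -
        have "0 \<le> real n * x" using True by simp
        then have "\<bar>real (nat \<lfloor>real n * x\<rfloor>) - real n * x\<bar> \<le> 1"
          by linarith
        moreover have "?y n - x = (real (nat \<lfloor>real n * x\<rfloor>) - real n * x) / real n"
          using n by (simp add: field_simps)
        ultimately show ?thesis
          using n by (simp add: abs_divide divide_right_mono)
      qed
      then have "eventually (\<lambda>n. norm (?y n - x) \<le> 1 / real n) sequentially"
        by (intro eventually_sequentiallyI[of 1]) simp
      moreover have "(\<lambda>n. 1 / real n) \<longlonglongrightarrow> 0"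
        by (rule lim_1_over_n)
      ultimately have "(\<lambda>n. ?y n - x) \<longlonglongrightarrow> 0"
        by (rule Lim_null_comparison)
      then have "?y \<longlonglongrightarrow> x"
        by (rule LIM_zero_cancel)
      then have "(\<lambda>n. g (?y n)) \<longlonglongrightarrow> g x"
        using cont True mem
        by (intro continuous_on_tendsto_compose[OF cont]) (auto intro!: eventually_sequentiallyI[of 1])
      moreover have "eventually (\<lambda>n. g (?y n) = s n x) sequentially"
        using True s_eq by (auto intro!: eventually_sequentiallyI[of 1])
      ultimately have "(\<lambda>n. s n x) \<longlonglongrightarrow> g x"
        by (rule Lim_transform_eventually)
      then show ?thesis
        using True by simp
    next
      case False
      have "eventually (\<lambda>n. 0 = s n x) sequentially"
        using False s_eq by (auto intro!: eventually_sequentiallyI[of 1])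
      with False show ?thesis
        by (auto intro: Lim_transform_eventually[OF tendsto_const])
    qed
    then show "AE x in lborel. (\<lambda>n. s n x) \<longlonglongrightarrow> indicator {0..<1} x *\<^sub>R g x"
      by simp
  qed
  moreover have "integral\<^sup>L lborel (s n) = (\<Sum>k<n. g (real k / real n)) / real n" for n
  proof -
    have "integral\<^sup>L lborel (s n)
      = (\<Sum>k<n. LINT x|lborel. indicator {real k / real n..<real (Suc k) / real n} x * g (real k / real n))"
      unfolding s_def
      by (intro Bochner_Integration.integral_sum integrable_mult_left integrable_real_indicator)
        (simp_all add: divide_right_mono)
    also have "\<dots> = (\<Sum>k<n. g (real k / real n) / real n)"
    proof (rule sum.cong[OF refl])
      fix k assume "k \<in> {..<n}"
      have "real (Suc k) / real n - real k / real n = 1 / real n"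
        by (simp add: diff_divide_distrib[symmetric])
      then show "(LINT x|lborel. indicator {real k / real n..<real (Suc k) / real n} x * g (real k / real n))
        = g (real k / real n) / real n"
        by (simp add: divide_right_mono)
    qed
    finally show ?thesis
      by (simp add: sum_divide_distrib)
  qed
  ultimately show ?thesis
    by (simp add: set_lebesgue_integral_def)
qed

lemma ereal_integral_integrable:
  assumes "set_integrable lborel S f" "\<And>x. x \<in> S \<Longrightarrow> F x = ereal (f x)"
  shows "ereal_integral S F = ereal (LINT x:S|lborel. f x)"
proof -
  let ?f = "\<lambda>x. indicator S x *\<^sub>R f x"
  have int: "integrable lborel ?f"
    using assms(1) by (simp add: set_integrable_def)
  have 1: "(\<integral>\<^sup>+ x\<in>S. e2ennreal (F x) \<partial>lborel) = (\<integral>\<^sup>+ x. ennreal (?f x) \<partial>lborel)"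
    by (intro nn_integral_cong) (auto simp: assms(2) indicator_def e2ennreal_ereal)
  have 2: "(\<integral>\<^sup>+ x\<in>S. e2ennreal (- F x) \<partial>lborel) = (\<integral>\<^sup>+ x. ennreal (- ?f x) \<partial>lborel)"
    by (intro nn_integral_cong) (auto simp: assms(2) indicator_def e2ennreal_ereal)
  have fin: "(\<integral>\<^sup>+ x. ennreal (?f x) \<partial>lborel) < \<infinity>" "(\<integral>\<^sup>+ x. ennreal (- ?f x) \<partial>lborel) < \<infinity>"
    using int by (auto simp: real_integrable_def top.not_eq_extremum)
  obtain a where a: "a \<ge> 0" "(\<integral>\<^sup>+ x. ennreal (?f x) \<partial>lborel) = ennreal a"
    using fin(1) by (cases "\<integral>\<^sup>+ x. ennreal (?f x) \<partial>lborel") auto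
  obtain b where b: "b \<ge> 0" "(\<integral>\<^sup>+ x. ennreal (- ?f x) \<partial>lborel) = ennreal b"
    using fin(2) by (cases "\<integral>\<^sup>+ x. ennreal (- ?f x) \<partial>lborel") auto
  note ab = a(1) b(1) a(2) b(2)
  have "(LINT x:S|lborel. f x) = a - b"
    using real_lebesgue_integral_def[OF int] ab by (simp add: set_lebesgue_integral_def)
  then show ?thesis
    unfolding ereal_integral_def 1 2 ab(3,4) using ab(1,2) by simp
qed

text \<open>As long as \<open>\<theta> * h x < lam\<close>, this is the logarithm of the expectation
  of \<open>exp (\<theta> * h x * Y)\<close> for an exponential Y of rate
  \<open>lam\<close>.\<close>

definition log_ratio :: "real \<Rightarrow> (real \<Rightarrow> real) \<Rightarrow> real \<Rightarrow> real \<Rightarrow> real" where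
  "log_ratio lam h \<theta> x = ln (lam / (lam - \<theta> * h x))"

text \<open>The denominator is affine in \<theta>, and minus the logarithm is convex.\<close>

lemma log_ratio_convex:
  assumes "lam > 0" "a * h x < lam" "b * h x < lam" "0 \<le> u" "0 \<le> v" "u + v = 1"
  shows "log_ratio lam h (u * a + v * b) x \<le> u * log_ratio lam h a x + v * log_ratio lam h b x"
proof -
  have eq: "lam - (u * a + v * b) * h x = u * (lam - a * h x) + v * (lam - b * h x)"
  proof -
    have "u * (lam - a * h x) + v * (lam - b * h x) = (u + v) * lam - (u * a + v * b) * h x"
      by (simp add: algebra_simps)
    then show ?thesis using assms(6) by simp
  qed
  have "convex {0::real<..}" by simp
  then have pos: "0 < u * (lam - a * h x) + v * (lam - b * h x)"
    using convexD[of "{0<..}" "lam - a * h x" "lam - b * h x" u v] assms by simp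
  have "u * ln (lam - a * h x) + v * ln (lam - b * h x) \<le> ln (u * (lam - a * h x) + v * (lam - b * h x))"
    using ln_concave assms unfolding concave_on_iff by auto
  moreover have "u * log_ratio lam h a x + v * log_ratio lam h b x
    = (u + v) * ln lam - (u * ln (lam - a * h x) + v * ln (lam - b * h x))"
    using assms(1-3) by (simp add: log_ratio_def ln_div algebra_simps)
  ultimately show ?thesis
    using assms(1,6) pos by (simp add: log_ratio_def eq ln_div)
qed

section \<open>The interior of the effective domain and the cumulant function on it\<close>

locale bounded_weight =
  fixes lam :: real and w :: "real \<Rightarrow> real" and B :: real
  assumes lam_pos: "0 < lam" and B_pos: "0 < B"
    and h_bound: "x \<in> {0..<1} \<Longrightarrow> \<bar>h_fun w x\<bar> \<le> B"
    and h_cont: "continuous_on {0..<1} (h_fun w)"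
begin

abbreviation h where "h \<equiv> h_fun w"
abbreviation lr where "lr \<equiv> log_ratio lam h"

text \<open>The gap below \<open>lam\<close> is uniform in x. A pointwise strict inequality would be
  weaker, because the supremum over \<open>{0..<1}\<close> need not be attained; the uniform gap
  gives openness of U and boundedness of the integrand.\<close>

definition U :: "real set" where
  "U = {\<theta>. \<exists>\<rho><lam. \<forall>x\<in>{0..<1}. \<theta> * h x \<le> \<rho>}"

lemma U_less: "\<theta> \<in> U \<Longrightarrow> x \<in> {0..<1} \<Longrightarrow> \<theta> * h x < lam"
  unfolding U_def by force

lemma mult_h_bound: "x \<in> {0..<1} \<Longrightarrow> \<bar>\<theta> * h x\<bar> \<le> \<bar>\<theta>\<bar> * B"
  using h_bound[of x] by (simp add: abs_mult mult_left_mono)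

lemma zero_mem_U: "0 \<in> U"
  using lam_pos by (auto simp: U_def)

lemma U_open: "open U"
  unfolding open_contains_ball
proof
  fix \<theta> assume "\<theta> \<in> U"
  then obtain \<rho> where r: "\<rho> < lam" "\<And>x. x \<in> {0..<1} \<Longrightarrow> \<theta> * h x \<le> \<rho>"
    by (auto simp: U_def)
  \<comment> \<open>Moving \<theta> by at most e changes \<open>\<theta> * h x\<close> by at most
    half of the gap \<open>lam - \<rho>\<close>.\<close>
  define e where "e = (lam - \<rho>) / (2 * B)"
  have e: "e > 0" "e * B = (lam - \<rho>) / 2"
    using r(1) B_pos by (auto simp: e_def)
  have "ball \<theta> e \<subseteq> U"
  proof
    fix \<eta> assume "\<eta> \<in> ball \<theta> e"
    then have d: "\<bar>\<eta> - \<theta>\<bar> \<le> e"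
      by (simp add: dist_real_def abs_minus_commute)
    have "\<eta> * h x \<le> \<rho> + e * B" if x: "x \<in> {0..<1}" for x
    proof -
      have "(\<eta> - \<theta>) * h x \<le> \<bar>\<eta> - \<theta>\<bar> * B"
        using mult_h_bound[OF x, of "\<eta> - \<theta>"] by (simp add: abs_le_iff)
      also have "\<dots> \<le> e * B"
        using d B_pos by (intro mult_right_mono) auto
      finally show ?thesis
        using r(2)[OF x] by (simp add: algebra_simps)
    qed
    moreover have "\<rho> + e * B < lam"
      using r(1) e(2) by (simp add: field_simps)
    ultimately show "\<eta> \<in> U"
      unfolding U_def by blast
  qed
  with e(1) show "\<exists>e>0. ball \<theta> e \<subseteq> U" by blast
qed

lemma U_convex: "convex U"
proof (rule convexI)
  fix a b u v :: real
  assume ab: "a \<in> U" "b \<in> U" and uv: "0 \<le> u" "0 \<le> v" "u + v = 1"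
  obtain \<rho> where r: "\<rho> < lam" "\<And>x. x \<in> {0..<1} \<Longrightarrow> a * h x \<le> \<rho>"
    using ab by (auto simp: U_def)
  obtain \<rho>' where r': "\<rho>' < lam" "\<And>x. x \<in> {0..<1} \<Longrightarrow> b * h x \<le> \<rho>'"
    using ab by (auto simp: U_def)
  have "(u * a + v * b) * h x \<le> max \<rho> \<rho>'" if x: "x \<in> {0..<1}" for x
  proof -
    have "u * (a * h x) + v * (b * h x) \<le> max \<rho> \<rho>'"
      by (rule convex_bound_le) (use r(2)[OF x] r'(2)[OF x] uv in auto)
    then show ?thesis by (simp add: algebra_simps)
  qed
  then show "u *\<^sub>R a + v *\<^sub>R b \<in> U"
    using r(1) r'(1) unfolding U_def by (auto intro!: exI[of _ "max \<rho> \<rho>'"])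
qed

lemma lr_cont: "\<theta> \<in> U \<Longrightarrow> continuous_on {0..<1} (lr \<theta>)"
  unfolding log_ratio_def using lam_pos U_less[of \<theta>]
  by (intro continuous_intros h_cont) force+

lemma lr_bounded:
  assumes "\<theta> \<in> U"
  shows "\<exists>C. \<forall>x\<in>{0..<1}. \<bar>lr \<theta> x\<bar> \<le> C"
proof -
  obtain \<rho> where r: "\<rho> < lam" "\<And>x. x \<in> {0..<1} \<Longrightarrow> \<theta> * h x \<le> \<rho>"
    using assms by (auto simp: U_def)
  have "\<bar>lr \<theta> x\<bar> \<le> \<bar>ln lam\<bar> + \<bar>ln (lam - \<rho>)\<bar> + \<bar>ln (lam + \<bar>\<theta>\<bar> * B)\<bar>" if x: "x \<in> {0..<1}" for x
  proof -
    have "ln (lam - \<rho>) \<le> ln (lam - \<theta> * h x)"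
      using r(1) r(2)[OF x] by (subst ln_le_cancel_iff) auto
    moreover have "ln (lam - \<theta> * h x) \<le> ln (lam + \<bar>\<theta>\<bar> * B)"
      using r(1) r(2)[OF x] mult_h_bound[OF x, of \<theta>] by (subst ln_le_cancel_iff) (auto simp: abs_le_iff)
    moreover have "lr \<theta> x = ln lam - ln (lam - \<theta> * h x)"
      using U_less[OF assms x] lam_pos by (simp add: log_ratio_def ln_div)
    ultimately show ?thesis by linarith
  qed
  then show ?thesis by blast
qed

lemma lr_integrable:
  assumes "\<theta> \<in> U"
  shows "set_integrable lborel {0..<1} (lr \<theta>)"
proof -
  obtain C where C: "\<And>x. x \<in> {0..<1} \<Longrightarrow> \<bar>lr \<theta> x\<bar> \<le> C"
    using lr_bounded[OF assms] by blast
  show ?thesis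
    unfolding set_integrable_def
  proof (rule Bochner_Integration.integrable_bound[of _ "\<lambda>x::real. indicator {0..<1} x * C"])
    show "integrable lborel (\<lambda>x::real. indicator {0..<1} x * C)"
      by (auto intro!: integrable_real_indicator)
    show "(\<lambda>x. indicator {0..<1} x *\<^sub>R lr \<theta> x) \<in> borel_measurable lborel"
      using borel_measurable_continuous_on_indicator[OF _ lr_cont[OF assms]] by simp
    show "AE x in lborel. norm (indicator {0..<1} x *\<^sub>R lr \<theta> x) \<le> norm (indicator {0..<1} x * C)"
      using C by (force simp: indicator_def)
  qed
qed

lemma Lambda_eq:
  assumes "\<theta> \<in> U"
  shows "Lambda lam w \<theta> = ereal (LINT x:{0..<1}|lborel. lr \<theta> x)"
proof -
  have "(SUP x\<in>{0..<1}. ereal (\<theta> * h x)) \<le> ereal lam"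
    using U_less[OF assms] by (intro SUP_least) (auto intro: less_imp_le)
  moreover have "ereal_integral {0..<1}
      (\<lambda>x. if \<theta> * h x = lam then \<infinity> else ereal (ln (lam / (lam - \<theta> * h x))))
    = ereal (LINT x:{0..<1}|lborel. lr \<theta> x)"
    by (rule ereal_integral_integrable[OF lr_integrable[OF assms]])
      (use U_less[OF assms] in \<open>force simp: log_ratio_def\<close>)
  ultimately show ?thesis
    by (simp add: Lambda_def)
qed

definition L :: "real \<Rightarrow> real" where
  "L \<theta> = real_of_ereal (Lambda lam w \<theta>)"

lemma L_eq: "\<theta> \<in> U \<Longrightarrow> L \<theta> = (LINT x:{0..<1}|lborel. lr \<theta> x)"
  by (simp add: L_def Lambda_eq)

lemma Lambda_eq_L: "\<theta> \<in> U \<Longrightarrow> Lambda lam w \<theta> = ereal (L \<theta>)"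
  by (simp add: L_def Lambda_eq)

lemma L_convex: "convex_on U L"
  unfolding convex_on_def
proof (intro conjI ballI allI impI)
  show "convex U" by (rule U_convex)
next
  fix a b u v :: real
  assume ab: "a \<in> U" "b \<in> U" and uv: "0 \<le> u" "0 \<le> v" "u + v = 1"
  let ?c = "u * a + v * b"
  have c: "?c \<in> U"
    using convexD[OF U_convex ab, of u v] uv by simp
  have int: "set_integrable lborel {0..<1} (\<lambda>x. u * lr a x)" "set_integrable lborel {0..<1} (\<lambda>x. v * lr b x)"
    using lr_integrable ab by auto
  have "L ?c = (LINT x:{0..<1}|lborel. lr ?c x)"
    using c by (rule L_eq)
  also have "\<dots> \<le> (LINT x:{0..<1}|lborel. u * lr a x + v * lr b x)"
  proof (rule set_integral_mono)
    show "set_integrable lborel {0..<1} (lr ?c)"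
      using c by (rule lr_integrable)
    show "set_integrable lborel {0..<1} (\<lambda>x. u * lr a x + v * lr b x)"
      using int by (rule set_integral_add)
    fix x :: real assume "x \<in> {0..<1}"
    then show "lr ?c x \<le> u * lr a x + v * lr b x"
      using U_less ab uv lam_pos by (intro log_ratio_convex) auto
  qed
  also have "\<dots> = u * L a + v * L b"
    using int ab by (simp add: set_integral_add L_eq)
  finally show "L (u *\<^sub>R a + v *\<^sub>R b) \<le> u * L a + v * L b"
    by simp
qed

lemma eff_domain_mult_h_le:
  assumes "\<theta> \<in> eff_domain (Lambda lam w)" "x \<in> {0..<1}"
  shows "\<theta> * h x \<le> lam"
proof -
  have "(SUP x\<in>{0..<1}. ereal (\<theta> * h x)) \<le> ereal lam"
    using assms(1) by (auto simp: eff_domain_def Lambda_def split: if_splits)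
  then have "ereal (\<theta> * h x) \<le> ereal lam"
    using assms(2) by (meson SUP_upper order_trans)
  then show ?thesis by simp
qed

text \<open>On the effective domain only \<open>\<theta> * h x \<le> lam\<close> is known; scaling
  by t opens the uniform gap \<open>(1 - t) * lam\<close>.\<close>

lemma shrink_mem_U:
  assumes "\<theta> \<in> eff_domain (Lambda lam w)" "0 < t" "t < 1"
  shows "t * \<theta> \<in> U"
proof -
  have "t * \<theta> * h x \<le> t * lam" if "x \<in> {0..<1}" for x
    using eff_domain_mult_h_le[OF assms(1) that] assms(2) by (simp add: mult.assoc)
  moreover have "t * lam < lam"
    using assms lam_pos by simp
  ultimately show ?thesis
    unfolding U_def by blast
qed

text \<open>Around an interior point \<theta> the domain still contains
  \<open>(1 + \<eta>) * \<theta>\<close>, and shrinking that point back to \<theta> lands in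
  U.\<close>

lemma interior_eff_domain: "interior (eff_domain (Lambda lam w)) = U"
proof
  have "U \<subseteq> eff_domain (Lambda lam w)"
    by (auto simp: eff_domain_def Lambda_eq)
  then show "U \<subseteq> interior (eff_domain (Lambda lam w))"
    using U_open by (rule interior_maximal)
  show "interior (eff_domain (Lambda lam w)) \<subseteq> U"
  proof
    fix \<theta> assume "\<theta> \<in> interior (eff_domain (Lambda lam w))"
    then obtain e where e: "e > 0" "ball \<theta> e \<subseteq> eff_domain (Lambda lam w)"
      by (auto simp: mem_interior)
    \<comment> \<open>This makes \<open>\<eta> * \<bar>\<theta>\<bar> < e\<close>; the added 1
      covers \<theta> = 0.\<close>
    define \<eta> where "\<eta> = e / (\<bar>\<theta>\<bar> + 1)"
    have eta: "\<eta> > 0" "\<eta> * (\<bar>\<theta>\<bar> + 1) = e"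
      using e(1) by (auto simp: \<eta>_def add_nonneg_pos)
    have "\<eta> * \<bar>\<theta>\<bar> < e"
      using eta by (simp add: distrib_left)
    then have "(1 + \<eta>) * \<theta> \<in> ball \<theta> e"
      using eta(1) by (simp add: dist_real_def distrib_right abs_mult)
    then have "(1 + \<eta>) * \<theta> \<in> eff_domain (Lambda lam w)"
      using e(2) by blast
    then have "1 / (1 + \<eta>) * ((1 + \<eta>) * \<theta>) \<in> U"
      by (rule shrink_mem_U) (use eta in auto)
    then show "\<theta> \<in> U"
      using eta(1) by simp
  qed
qed

text \<open>Convexity of the integrand between 0, where it vanishes, and \<theta>. The integrand at
  \<theta> may take the value \<infinity> and is not yet known to be integrable, so the integrals of
  the positive and of the negative part are compared separately.\<close>

lemma Lambda_shrink_le: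
  assumes th: "\<theta> \<in> eff_domain (Lambda lam w)" and t: "0 < t" "t < 1"
  shows "Lambda lam w (t * \<theta>) \<le> ereal t * Lambda lam w \<theta>"
proof -
  let ?F = "\<lambda>\<theta> x. if \<theta> * h x = lam then \<infinity> else ereal (ln (lam / (lam - \<theta> * h x)))"
  let ?P = "\<lambda>\<theta>. \<integral>\<^sup>+ x\<in>{0..<1}. e2ennreal (?F \<theta> x) \<partial>lborel"
  let ?N = "\<lambda>\<theta>. \<integral>\<^sup>+ x\<in>{0..<1}. e2ennreal (- ?F \<theta> x) \<partial>lborel"
  have tU: "t * \<theta> \<in> U"
    using assms by (rule shrink_mem_U)
  have dom: "\<eta> \<in> eff_domain (Lambda lam w) \<Longrightarrow> Lambda lam w \<eta> = enn2ereal (?P \<eta>) - enn2ereal (?N \<eta>)" for \<eta>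
    by (auto simp: eff_domain_def Lambda_def ereal_integral_def split: if_splits)
  have tD: "t * \<theta> \<in> eff_domain (Lambda lam w)"
    using tU interior_eff_domain interior_subset by blast
  have pw: "?F (t * \<theta>) x \<le> ereal t * ?F \<theta> x" if x: "x \<in> {0..<1}" for x
  proof (cases "\<theta> * h x = lam")
    case True
    then show ?thesis using t by simp
  next
    case False
    then have "\<theta> * h x < lam"
      using eff_domain_mult_h_le[OF th x] by simp
    then have "lr (t * \<theta> + (1 - t) * 0) x \<le> t * lr \<theta> x + (1 - t) * lr 0 x"
      using t lam_pos by (intro log_ratio_convex) auto
    then show ?thesis
      using False U_less[OF tU x] lam_pos by (simp add: log_ratio_def)
  qed
  have scale: "e2ennreal (ereal t * y) = ennreal t * e2ennreal y" for y
    using t by (cases y) (auto simp: e2ennreal_ereal ennreal_mult'' ennreal_mult' ennreal_mult_top e2ennreal_neg)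
  \<comment> \<open>Continuity is known on \<open>{0..<1}\<close> only; cutting h off outside gives
    a measurable function on the whole line with the same integrals.\<close>
  define h' where "h' x = indicator {0..<1} x * h x" for x
  have [measurable]: "h' \<in> borel_measurable lborel"
    using borel_measurable_continuous_on_indicator[OF _ h_cont] unfolding h'_def[abs_def] by simp
  have h': "h' x = h x" if "x \<in> {0..<1}" for x
    using that by (simp add: h'_def)
  let ?G = "\<lambda>x. if \<theta> * h' x = lam then \<infinity> else ereal (ln (lam / (lam - \<theta> * h' x)))"
  have FG: "e2ennreal (?F \<theta> x) * indicator {0..<1} x = e2ennreal (?G x) * indicator {0..<1} x"
    "e2ennreal (- ?F \<theta> x) * indicator {0..<1} x = e2ennreal (- ?G x) * indicator {0..<1} x" for x
    using h'[of x] by (cases "x \<in> {0..<1}"; simp only: indicator_simps mult_zero_right)+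
  have P: "?P (t * \<theta>) \<le> ennreal t * ?P \<theta>"
  proof -
    have "?P (t * \<theta>) \<le> (\<integral>\<^sup>+ x. ennreal t * (e2ennreal (?F \<theta> x) * indicator {0..<1} x) \<partial>lborel)"
    proof (rule nn_integral_mono)
      fix x
      show "e2ennreal (?F (t * \<theta>) x) * indicator {0..<1} x
        \<le> ennreal t * (e2ennreal (?F \<theta> x) * indicator {0..<1} x)"
      proof (cases "x \<in> {0..<1}")
        case True
        from e2ennreal_mono[OF pw[OF True]] True show ?thesis
          unfolding scale by (simp only: indicator_simps mult_1_right)
      next
        case False
        then have "indicator {0..<1} x = (0 :: ennreal)"
          by (rule indicator_simps)
        then show ?thesis
          by (simp only: mult_zero_right order_refl)
      qed
    qed
    also have "\<dots> = ennreal t * ?P \<theta>"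
      unfolding FG by (rule nn_integral_cmult) measurable
    finally show ?thesis .
  qed
  have N: "ennreal t * ?N \<theta> \<le> ?N (t * \<theta>)"
  proof -
    have "ennreal t * ?N \<theta> = (\<integral>\<^sup>+ x. ennreal t * (e2ennreal (- ?F \<theta> x) * indicator {0..<1} x) \<partial>lborel)"
      unfolding FG by (rule nn_integral_cmult[symmetric]) measurable
    also have "\<dots> \<le> ?N (t * \<theta>)"
    proof (rule nn_integral_mono)
      fix x
      show "ennreal t * (e2ennreal (- ?F \<theta> x) * indicator {0..<1} x)
        \<le> e2ennreal (- ?F (t * \<theta>) x) * indicator {0..<1} x"
      proof (cases "x \<in> {0..<1}")
        case True
        have "ereal t * - ?F \<theta> x \<le> - ?F (t * \<theta>) x"
          using pw[OF True] by (simp only: ereal_mult_minus_right ereal_minus_le_minus)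
        from e2ennreal_mono[OF this] True show ?thesis
          unfolding scale by (simp only: indicator_simps mult_1_right)
      next
        case False
        then have "indicator {0..<1} x = (0 :: ennreal)"
          by (rule indicator_simps)
        then show ?thesis
          by (simp only: mult_zero_right order_refl)
      qed
    qed
    finally show ?thesis .
  qed
  have enn: "enn2ereal (ennreal t * y) = ereal t * enn2ereal y" for y
    using t by (simp add: times_ennreal.rep_eq)
  have dist: "ereal t * a - ereal t * b = ereal t * (a - b)" if "0 \<le> a" "0 \<le> b" for a b
    using that t by (cases a; cases b) (auto simp: right_diff_distrib)
  have "Lambda lam w (t * \<theta>) = enn2ereal (?P (t * \<theta>)) - enn2ereal (?N (t * \<theta>))"
    using tD by (rule dom)
  also have "\<dots> \<le> enn2ereal (ennreal t * ?P \<theta>) - enn2ereal (ennreal t * ?N \<theta>)"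
    using P N by (intro ereal_minus_mono) (simp_all only: less_eq_ennreal.rep_eq)
  also have "\<dots> = ereal t * Lambda lam w \<theta>"
    unfolding enn dom[OF th] by (rule dist) simp_all
  finally show ?thesis .
qed

end

section \<open>A one-dimensional Gaertner-Ellis theorem\<close>

text \<open>All conditions concern the open set U. The real exponent \<open>K n \<theta>\<close>
  encodes that the moment generating function is finite there. For a limit b of points of U,
  \<open>b \<notin> U\<close> says that b is a boundary point.\<close>

locale cumulant_limit = prob_space M for M :: "'a measure" +
  fixes Z :: "nat \<Rightarrow> 'a \<Rightarrow> real" and K :: "nat \<Rightarrow> real \<Rightarrow> real" and L :: "real \<Rightarrow> real" and U :: "real set"
  assumes Z_measurable: "n \<ge> 1 \<Longrightarrow> Z n \<in> borel_measurable M"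
    and mgf: "n \<ge> 1 \<Longrightarrow> \<theta> \<in> U \<Longrightarrow>
      (\<integral>\<^sup>+ \<omega>. ennreal (exp (real n * \<theta> * Z n \<omega>)) \<partial>M) = ennreal (exp (real n * K n \<theta>))"
    and K_tendsto: "\<theta> \<in> U \<Longrightarrow> (\<lambda>n. K n \<theta>) \<longlonglongrightarrow> L \<theta>"
    and open_U: "open U" and convex_U: "convex U" and zero_U: "0 \<in> U"
    and convex_L: "convex_on U L"
    and diff_L: "\<theta> \<in> U \<Longrightarrow> L differentiable (at \<theta>)"
    and steep: "(\<And>n::nat. s n \<in> U) \<Longrightarrow> b \<notin> U \<Longrightarrow> s \<longlonglongrightarrow> b \<Longrightarrow>
      filterlim (\<lambda>n. \<bar>deriv L (s n)\<bar>) at_top sequentially"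
begin

section \<open>Elementary properties of the rate function\<close>

definition rate :: "real \<Rightarrow> ereal" where
  "rate y = (SUP \<theta>\<in>U. ereal (\<theta> * y - L \<theta>))"

lemma L_deriv: "\<theta> \<in> U \<Longrightarrow> (L has_real_derivative deriv L \<theta>) (at \<theta>)"
  using diff_L by (metis DERIV_imp_deriv real_differentiable_def)

lemma K_zero: "n \<ge> 1 \<Longrightarrow> K n 0 = 0"
  using mgf[of n 0] zero_U by (simp add: emeasure_space_1)

lemma L_zero: "L 0 = 0"
proof -
  have "(\<lambda>n. K n 0) \<longlonglongrightarrow> 0"
    by (rule tendsto_eventually) (use K_zero in \<open>auto intro!: eventually_sequentiallyI[of 1]\<close>)
  with K_tendsto[OF zero_U] show ?thesis
    using LIMSEQ_unique by blast
qed

lemma L_tangent: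
  assumes "\<theta> \<in> U" "\<eta> \<in> U"
  shows "deriv L \<theta> * (\<eta> - \<theta>) \<le> L \<eta> - L \<theta>"
proof -
  have "(L has_real_derivative deriv L \<theta>) (at \<theta> within U)"
    using L_deriv[OF assms(1)] by (rule has_field_derivative_at_within)
  moreover have "\<theta> \<in> interior U"
    using assms open_U by (simp add: interior_open)
  moreover have "connected U"
    using convex_U by (rule convex_connected)
  ultimately show ?thesis
    using convex_on_imp_above_tangent[OF convex_L] assms by blast
qed

lemma rate_upper: "\<theta> \<in> U \<Longrightarrow> ereal (\<theta> * y - L \<theta>) \<le> rate y"
  unfolding rate_def by (rule SUP_upper)

lemma rate_nonneg: "0 \<le> rate y"
  using rate_upper[OF zero_U, of y] L_zero by (simp flip: zero_ereal_def)

text \<open>The tangent of L at 0 passes through the origin and lies below L. This point is the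
  typical value at which closed sets are split for the upper bound.\<close>

lemma rate_deriv_zero: "rate (deriv L 0) = 0"
proof (rule antisym[OF _ rate_nonneg])
  show "rate (deriv L 0) \<le> 0"
    unfolding rate_def
  proof (rule SUP_least)
    fix \<theta> assume "\<theta> \<in> U"
    from L_tangent[OF zero_U this] L_zero
    show "ereal (\<theta> * deriv L 0 - L \<theta>) \<le> 0"
      by (simp add: mult.commute)
  qed
qed

lemma closed_rate_level: "closed {x. rate x \<le> r}"
proof -
  have "{x. rate x \<le> r} = (\<Inter>\<theta>\<in>U. {x. ereal (\<theta> * x - L \<theta>) \<le> r})"
    by (auto simp: rate_def SUP_le_iff)
  moreover have "closed {x. ereal (\<theta> * x - L \<theta>) \<le> r}" for \<theta>
    by (intro closed_Collect_le continuous_intros)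
  ultimately show ?thesis
    by auto
qed

lemma rate_lsc: "lower_semicontinuous rate"
  unfolding lower_semicontinuous_def
proof
  fix x
  show "rate x \<le> Liminf (at x) rate"
    unfolding le_Liminf_iff
  proof (intro allI impI)
    fix y assume "y < rate x"
    have "open (- {x. rate x \<le> y})"
      using closed_rate_level by blast
    moreover have "x \<in> - {x. rate x \<le> y}"
      using \<open>y < rate x\<close> by auto
    ultimately have "eventually (\<lambda>z. z \<in> - {x. rate x \<le> y}) (nhds x)"
      by (rule eventually_nhds_in_open)
    then show "eventually (\<lambda>z. y < rate z) (at x)"
      by (auto simp: eventually_at_filter elim: eventually_mono)
  qed
qed

text \<open>Testing the supremum at e and -e, both in U, gives the rate at least linear growth, so
  level sets are bounded.\<close>

lemma rate_good: "good_rate rate"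
  unfolding good_rate_def
proof (intro allI impI)
  fix \<eta> :: real
  obtain e where e: "e > 0" "cball 0 e \<subseteq> U"
    using open_U zero_U open_contains_cball by blast
  have eU: "e \<in> U" "-e \<in> U"
    using e by (auto simp: cball_def dist_norm)
  let ?c = "(\<eta> + \<bar>L e\<bar> + \<bar>L (-e)\<bar>) / e"
  have "\<bar>x\<bar> \<le> ?c" if "rate x \<le> ereal \<eta>" for x
  proof -
    have "e * x - L e \<le> \<eta>" "(-e) * x - L (-e) \<le> \<eta>"
      using rate_upper[OF eU(1), of x] rate_upper[OF eU(2), of x] that
      by (metis ereal_less_eq(3) order_trans)+
    then have "e * \<bar>x\<bar> \<le> \<eta> + \<bar>L e\<bar> + \<bar>L (-e)\<bar>"
      by (auto simp: abs_if)
    then show ?thesis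
      using e by (simp add: field_simps)
  qed
  then have "bounded {x. rate x \<le> ereal \<eta>}"
    by (intro boundedI) auto
  then show "compact {x. rate x \<le> ereal \<eta>}"
    using closed_rate_level by (simp add: compact_eq_bounded_closed)
qed

text \<open>Common source of both large deviation bounds: \<theta> = 0 gives the usual Chernoff
  estimate, while \<theta>' close to a nonzero or zero \<theta> bounds the tails of the tilted
  integral.\<close>

lemma tilted_chernoff:
  assumes n: "n \<ge> 1" and th: "\<theta>' \<in> U" and A: "A \<in> sets M"
    and le: "\<And>\<omega>. \<omega> \<in> A \<Longrightarrow> \<theta> * Z n \<omega> \<le> c + \<theta>' * Z n \<omega>"
  shows "(\<integral>\<^sup>+ \<omega>\<in>A. ennreal (exp (real n * \<theta> * Z n \<omega>)) \<partial>M) \<le> ennreal (exp (real n * (c + K n \<theta>')))"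
proof -
  have [measurable]: "Z n \<in> borel_measurable M"
    using Z_measurable n by auto
  have "(\<integral>\<^sup>+ \<omega>\<in>A. ennreal (exp (real n * \<theta> * Z n \<omega>)) \<partial>M)
    \<le> (\<integral>\<^sup>+ \<omega>. ennreal (exp (real n * c)) * ennreal (exp (real n * \<theta>' * Z n \<omega>)) \<partial>M)"
  proof (rule nn_integral_mono)
    fix \<omega>
    show "ennreal (exp (real n * \<theta> * Z n \<omega>)) * indicator A \<omega>
      \<le> ennreal (exp (real n * c)) * ennreal (exp (real n * \<theta>' * Z n \<omega>))"
    proof (cases "\<omega> \<in> A")
      case True
      have "real n * \<theta> * Z n \<omega> \<le> real n * c + real n * \<theta>' * Z n \<omega>"
        using mult_left_mono[OF le[OF True], of "real n"] by (simp add: algebra_simps)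
      then show ?thesis
        using True by (simp flip: ennreal_mult add: exp_add[symmetric])
    qed simp
  qed
  also have "\<dots> = ennreal (exp (real n * c)) * ennreal (exp (real n * K n \<theta>'))"
    using mgf[OF n th] by (subst nn_integral_cmult) simp_all
  also have "\<dots> = ennreal (exp (real n * (c + K n \<theta>')))"
    by (simp add: ennreal_mult[symmetric] exp_add[symmetric] distrib_left)
  finally show ?thesis .
qed

section \<open>Upper bound for closed sets\<close>

lemma chernoff:
  assumes n: "n \<ge> 1" and th: "\<theta> \<in> U" and A: "A \<in> sets M"
    and le: "\<And>\<omega>. \<omega> \<in> A \<Longrightarrow> \<theta> * x \<le> \<theta> * Z n \<omega>"
  shows "prob A \<le> exp (- (real n * (\<theta> * x - K n \<theta>)))"
proof -
  have "ennreal (prob A) = (\<integral>\<^sup>+ \<omega>\<in>A. ennreal (exp (real n * 0 * Z n \<omega>)) \<partial>M)"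
    using A by (simp add: emeasure_eq_measure)
  also have "\<dots> \<le> ennreal (exp (real n * (- (\<theta> * x) + K n \<theta>)))"
    by (rule tilted_chernoff[OF n th A]) (use le in force)
  finally show ?thesis
    by (simp add: algebra_simps)
qed

text \<open>The sign \<sigma> treats both half-lines pointing away from the typical value
  \<open>deriv L 0\<close> at once. For negative r the bound exceeds 1.\<close>

lemma eventually_half_line:
  assumes x: "deriv L 0 < x \<and> \<sigma> = 1 \<or> x < deriv L 0 \<and> \<sigma> = -1" and r: "ereal r < rate x"
  shows "eventually (\<lambda>n. prob {\<omega> \<in> space M. \<sigma> * x \<le> \<sigma> * Z n \<omega>} \<le> exp (- (real n * r))) sequentially"
proof (cases "r < 0")
  case True
  have "prob {\<omega> \<in> space M. \<sigma> * x \<le> \<sigma> * Z n \<omega>} \<le> exp (- (real n * r))" for n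
  proof -
    have "0 \<le> - (real n * r)" using True by (simp add: mult_le_0_iff)
    then have "1 \<le> exp (- (real n * r))" by (simp only: one_le_exp_iff)
    then show ?thesis using prob_le_1 order_trans by blast
  qed
  then show ?thesis by simp
next
  case False
  obtain \<theta> where th: "\<theta> \<in> U" "r < \<theta> * x - L \<theta>"
    using r unfolding rate_def less_SUP_iff by auto
  \<comment> \<open>The tangent at 0 gives \<open>\<theta> * (x - deriv L 0) \<ge> \<theta> * x - L
    \<theta> > r \<ge> 0\<close>, so \<theta> has the sign that makes the Chernoff bound point
    outwards.\<close>
  have "deriv L 0 * \<theta> \<le> L \<theta>"
    using L_tangent[OF zero_U th(1)] L_zero by simp
  with th(2) False have "0 < \<theta> * (x - deriv L 0)"
    by (simp add: algebra_simps)
  then have sg: "0 < \<sigma> * \<theta>"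
    using x by (auto simp: zero_less_mult_iff)
  have "(\<lambda>n. \<theta> * x - K n \<theta>) \<longlonglongrightarrow> \<theta> * x - L \<theta>"
    by (intro tendsto_intros K_tendsto th)
  then have "eventually (\<lambda>n. r < \<theta> * x - K n \<theta>) sequentially"
    using th(2) by (rule order_tendstoD)
  with eventually_ge_at_top[of 1] show ?thesis
  proof eventually_elim
    case (elim n)
    have [measurable]: "Z n \<in> borel_measurable M"
      using Z_measurable elim by auto
    have "prob {\<omega> \<in> space M. \<sigma> * x \<le> \<sigma> * Z n \<omega>} \<le> exp (- (real n * (\<theta> * x - K n \<theta>)))"
    proof (rule chernoff[OF elim(1) th(1)])
      fix \<omega> assume "\<omega> \<in> {\<omega> \<in> space M. \<sigma> * x \<le> \<sigma> * Z n \<omega>}"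
      then have "(\<sigma> * \<theta>) * (\<sigma> * x) \<le> (\<sigma> * \<theta>) * (\<sigma> * Z n \<omega>)"
        using sg by (metis (mono_tags, lifting) less_imp_le mem_Collect_eq mult_left_mono)
      then show "\<theta> * x \<le> \<theta> * Z n \<omega>"
        using x by auto
    qed measurable
    also have "\<dots> \<le> exp (- (real n * r))"
      using elim by (simp add: mult_left_mono)
    finally show ?case .
  qed
qed

text \<open>The factor 2 accounts for the two sides of the typical value; its contribution
  \<open>ln 2 / n\<close> vanishes in the limit.\<close>

lemma scaled_log_prob_le:
  assumes "p \<le> 2 * exp (- (real n * r))" "n \<ge> 1"
  shows "ereal (1 / real n) * log_prob p \<le> ereal (ln 2 / real n - r)"
proof (cases "p > 0")
  case True
  then have "ln p \<le> ln (2 * exp (- (real n * r)))"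
    using assms by (subst ln_le_cancel_iff) auto
  also have "\<dots> = ln 2 - real n * r"
    by (simp add: ln_mult)
  finally show ?thesis
    using True assms by (simp add: log_prob_def field_simps)
qed (use assms in \<open>simp add: log_prob_def\<close>)

lemma limsup_le_of_exp_bound:
  assumes "eventually (\<lambda>n. p n \<le> 2 * exp (- (real n * r))) sequentially"
  shows "limsup (\<lambda>n. ereal (1 / real n) * log_prob (p n)) \<le> ereal (- r)"
proof -
  have "limsup (\<lambda>n. ereal (1 / real n) * log_prob (p n)) \<le> limsup (\<lambda>n. ereal (ln 2 / real n - r))"
    by (rule Limsup_mono, use assms eventually_ge_at_top[of "1::nat"] in eventually_elim)
      (rule scaled_log_prob_le)
  also have "(\<lambda>n. ereal (ln 2 / real n - r)) \<longlonglongrightarrow> ereal (0 - r)"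
    by (intro tendsto_intros tendsto_divide_0[OF tendsto_const] filterlim_at_top_imp_at_infinity
      filterlim_real_sequentially)
  then have "limsup (\<lambda>n. ereal (ln 2 / real n - r)) = ereal (- r)"
    by (simp add: lim_imp_Limsup)
  finally show ?thesis .
qed

lemma upper_bound:
  assumes "closed C"
  shows "limsup (\<lambda>n. ereal (1 / real n) * log_prob (prob {\<omega> \<in> space M. Z n \<omega> \<in> C}))
    \<le> - (INF x\<in>C. rate x)"
proof -
  let ?p = "\<lambda>n. prob {\<omega> \<in> space M. Z n \<omega> \<in> C}"
  define m where "m = deriv L 0"
  \<comment> \<open>Working with a real r strictly below the infimum also covers an infinite
    infimum. If m lies in C, the infimum is at most \<open>rate m = 0\<close>, so r is negative and
    the bound is trivial.\<close>
  have main: "eventually (\<lambda>n. ?p n \<le> 2 * exp (- (real n * r))) sequentially"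
    if r: "ereal r < (INF x\<in>C. rate x)" for r
  proof (cases "m \<in> C")
    case True
    then have "(INF x\<in>C. rate x) \<le> rate m"
      by (rule INF_lower)
    then have "r < 0"
      using r rate_deriv_zero unfolding m_def by (metis ereal_less(2) less_le_trans ereal_less_eq(3) zero_ereal_def less_ereal.simps(1))
    have "?p n \<le> 2 * exp (- (real n * r))" for n
    proof -
      have "0 \<le> - (real n * r)" using \<open>r < 0\<close> by (simp add: mult_le_0_iff)
      then have "1 \<le> exp (- (real n * r))" by (simp only: one_le_exp_iff)
      then show ?thesis using prob_le_1[of "{\<omega> \<in> space M. Z n \<omega> \<in> C}"] by linarith
    qed
    then show ?thesis by simp
  next
    case False
    \<comment> \<open>Each side of C lies in the half-line that starts at the point x of that side
      nearest to m. As C is closed, x belongs to C, so its rate is at least the infimum.\<close>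
    have half: "\<exists>x. (m < x \<and> \<sigma> = 1 \<or> x < m \<and> \<sigma> = -1) \<and> ereal r < rate x \<and>
        (\<forall>z\<in>C. \<sigma> * m \<le> \<sigma> * z \<longrightarrow> \<sigma> * x \<le> \<sigma> * z)"
      if sg: "\<sigma> = 1 \<or> \<sigma> = -1" and ne: "\<exists>z\<in>C. \<sigma> * m \<le> \<sigma> * z" for \<sigma>
    proof -
      let ?D = "{z \<in> C. \<sigma> * m \<le> \<sigma> * z}"
      have "closed ?D"
      proof -
        have "closed (C \<inter> {z. \<sigma> * m \<le> \<sigma> * z})"
          by (intro closed_Int assms closed_Collect_le continuous_intros)
        then show ?thesis by (simp add: Int_def)
      qed
      moreover have "?D \<noteq> {}" using ne by auto
      ultimately obtain x where x: "x \<in> ?D" "\<And>y. y \<in> ?D \<Longrightarrow> dist m x \<le> dist m y"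
        using distance_attains_inf by blast
      have "x \<noteq> m" using x False by auto
      moreover have "ereal r < rate x"
        using r x(1) by (auto simp: less_le_trans[OF _ INF_lower])
      moreover have "\<sigma> * x \<le> \<sigma> * z" if "z \<in> C" "\<sigma> * m \<le> \<sigma> * z" for z
        using x(2)[of z] that x(1) sg by (auto simp: dist_real_def)
      ultimately show ?thesis
        using sg x(1) by (intro exI[of _ x]) auto
    qed
    have ev: "eventually (\<lambda>n. prob {\<omega> \<in> space M. Z n \<omega> \<in> C \<and> \<sigma> * m \<le> \<sigma> * Z n \<omega>} \<le> exp (- (real n * r)))
      sequentially" if sg: "\<sigma> = 1 \<or> \<sigma> = -1" for \<sigma>
    proof (cases "\<exists>z\<in>C. \<sigma> * m \<le> \<sigma> * z")
      case True
      from half[OF sg this] obtain x where x: "m < x \<and> \<sigma> = 1 \<or> x < m \<and> \<sigma> = -1"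
        "ereal r < rate x" "\<And>z. z \<in> C \<Longrightarrow> \<sigma> * m \<le> \<sigma> * z \<Longrightarrow> \<sigma> * x \<le> \<sigma> * z" by blast
      show ?thesis
        using eventually_half_line[OF x(1)[unfolded m_def] x(2)] eventually_ge_at_top[of 1]
      proof eventually_elim
        case (elim n)
        have [measurable]: "Z n \<in> borel_measurable M"
          using Z_measurable elim by auto
        have "prob {\<omega> \<in> space M. Z n \<omega> \<in> C \<and> \<sigma> * m \<le> \<sigma> * Z n \<omega>}
          \<le> prob {\<omega> \<in> space M. \<sigma> * x \<le> \<sigma> * Z n \<omega>}"
          by (rule finite_measure_mono) (use x(3) in auto)
        with elim show ?case by linarith
      qed
    next
      case False
      then have "{\<omega> \<in> space M. Z n \<omega> \<in> C \<and> \<sigma> * m \<le> \<sigma> * Z n \<omega>} = {}" for n by auto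
      then show ?thesis by (simp only: measure_empty) simp
    qed
    show ?thesis
      using ev[of 1, simplified] ev[of "-1", simplified] eventually_ge_at_top[of 1]
    proof eventually_elim
      case (elim n)
      have [measurable]: "Z n \<in> borel_measurable M" "C \<in> sets borel"
        using Z_measurable elim assms by auto
      let ?A = "\<lambda>\<sigma>. {\<omega> \<in> space M. Z n \<omega> \<in> C \<and> \<sigma> * m \<le> \<sigma> * Z n \<omega>}"
      have "?p n \<le> prob (?A 1 \<union> ?A (-1))"
        by (intro finite_measure_mono) auto
      also have "\<dots> \<le> prob (?A 1) + prob (?A (-1))"
        by (rule measure_Un_le) auto
      finally show ?case using elim by simp
    qed
  qed
  show ?thesis
  proof (rule ccontr)
    assume "\<not> ?thesis"
    then have "- (INF x\<in>C. rate x) < limsup (\<lambda>n. ereal (1 / real n) * log_prob (?p n))" by simp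
    then obtain r where r: "- (INF x\<in>C. rate x) < ereal r" "ereal r < limsup (\<lambda>n. ereal (1 / real n) * log_prob (?p n))"
      using ereal_dense2 by blast
    have "ereal (- r) < (INF x\<in>C. rate x)"
      using r(1) by (metis ereal_uminus_less_reorder uminus_ereal.simps(1))
    from limsup_le_of_exp_bound[OF main[OF this]] r(2) show False by simp
  qed
qed


section \<open>Lower bound near an attained slope\<close>

lemma eventually_tail:
  assumes th: "\<theta> \<in> U" and d: "\<delta> > 0" and sg: "\<sigma> = 1 \<or> \<sigma> = -1"
  shows "\<exists>\<kappa>>0. eventually (\<lambda>n.
    (\<integral>\<^sup>+ \<omega>\<in>{\<omega> \<in> space M. \<delta> \<le> \<sigma> * (Z n \<omega> - deriv L \<theta>)}. ennreal (exp (real n * \<theta> * Z n \<omega>)) \<partial>M)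
      \<le> ennreal (exp (real n * (L \<theta> - \<kappa>)))) sequentially"
proof -
  let ?y = "deriv L \<theta>"
  \<comment> \<open>Moving the parameter by \<open>\<sigma> * \<eta>\<close> changes L by
    \<open>\<sigma> * \<eta> * ?y\<close> up to an error below \<open>\<eta> * \<delta>\<close>,
    whereas on the tail the exponent gains at least \<open>\<eta> * \<delta>\<close> beyond that
    linear term. The tail therefore loses a fixed exponential rate.\<close>
  have "(\<lambda>h. (L (\<theta> + h) - L \<theta>) / h) \<midarrow>0\<rightarrow> ?y"
    using L_deriv[OF th] by (simp add: DERIV_def)
  then have "eventually (\<lambda>h. dist ((L (\<theta> + h) - L \<theta>) / h) ?y < \<delta>) (at 0)"
    using d by (rule tendstoD)
  then obtain r where r: "r > 0" "\<And>h. h \<noteq> 0 \<Longrightarrow> \<bar>h\<bar> < r \<Longrightarrow> dist ((L (\<theta> + h) - L \<theta>) / h) ?y < \<delta>"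
    by (auto simp: eventually_at dist_real_def)
  obtain e where e: "e > 0" "cball \<theta> e \<subseteq> U"
    using open_U th open_contains_cball by blast
  define \<eta> where "\<eta> = min e (r / 2)"
  have eta: "\<eta> > 0" "\<eta> < r" "\<eta> \<le> e"
    using r(1) e(1) by (auto simp: \<eta>_def)
  let ?h = "\<sigma> * \<eta>"
  have hU: "\<theta> + ?h \<in> U"
    using e eta sg by (intro subsetD[OF e(2)]) (auto simp: dist_real_def)
  have "\<bar>(L (\<theta> + ?h) - L \<theta>) / ?h - ?y\<bar> < \<delta>"
    using r(2)[of ?h] eta sg by (auto simp: dist_real_def)
  then have *: "\<bar>(L (\<theta> + ?h) - L \<theta>) / ?h - ?y\<bar> * \<bar>?h\<bar> < \<delta> * \<bar>?h\<bar>"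
    using eta sg by (intro mult_strict_right_mono) auto
  have "\<bar>L (\<theta> + ?h) - L \<theta> - ?h * ?y\<bar> < \<delta> * \<eta>"
  proof -
    have "?h \<noteq> 0" "\<bar>?h\<bar> = \<eta>"
      using eta sg by auto
    moreover from this(1) have "((L (\<theta> + ?h) - L \<theta>) / ?h - ?y) * ?h = L (\<theta> + ?h) - L \<theta> - ?h * ?y"
      by (metis left_diff_distrib mult.commute nonzero_eq_divide_eq)
    ultimately show ?thesis
      using * by (metis abs_mult)
  qed
  then have lt: "L (\<theta> + ?h) - (?h * ?y + \<eta> * \<delta>) < L \<theta>"
    by (simp add: mult.commute abs_less_iff)
  \<comment> \<open>Half of the gain; the other half absorbs the difference between
    \<open>K n\<close> and L for large n.\<close>
  define \<kappa> where "\<kappa> = (L \<theta> - (L (\<theta> + ?h) - (?h * ?y + \<eta> * \<delta>))) / 2"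
  have k: "\<kappa> > 0" "L (\<theta> + ?h) - (?h * ?y + \<eta> * \<delta>) < L \<theta> - \<kappa>"
    using lt unfolding \<kappa>_def by (simp_all add: field_simps)
  have "(\<lambda>n. - (?h * ?y + \<eta> * \<delta>) + K n (\<theta> + ?h)) \<longlonglongrightarrow> - (?h * ?y + \<eta> * \<delta>) + L (\<theta> + ?h)"
    by (intro tendsto_intros K_tendsto hU)
  then have "eventually (\<lambda>n. - (?h * ?y + \<eta> * \<delta>) + K n (\<theta> + ?h) < L \<theta> - \<kappa>) sequentially"
    by (rule order_tendstoD) (use k in simp)
  with eventually_ge_at_top[of 1]
  have "eventually (\<lambda>n.
    (\<integral>\<^sup>+ \<omega>\<in>{\<omega> \<in> space M. \<delta> \<le> \<sigma> * (Z n \<omega> - ?y)}. ennreal (exp (real n * \<theta> * Z n \<omega>)) \<partial>M)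
      \<le> ennreal (exp (real n * (L \<theta> - \<kappa>)))) sequentially"
  proof eventually_elim
    case (elim n)
    have [measurable]: "Z n \<in> borel_measurable M"
      using Z_measurable elim by auto
    have "(\<integral>\<^sup>+ \<omega>\<in>{\<omega> \<in> space M. \<delta> \<le> \<sigma> * (Z n \<omega> - ?y)}. ennreal (exp (real n * \<theta> * Z n \<omega>)) \<partial>M)
      \<le> ennreal (exp (real n * (- (?h * ?y + \<eta> * \<delta>) + K n (\<theta> + ?h))))"
    proof (rule tilted_chernoff[OF elim(1) hU])
      fix \<omega> assume "\<omega> \<in> {\<omega> \<in> space M. \<delta> \<le> \<sigma> * (Z n \<omega> - ?y)}"
      then have "\<eta> * \<delta> \<le> \<eta> * (\<sigma> * (Z n \<omega> - ?y))"
        using eta(1) by (intro mult_left_mono) auto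
      then show "\<theta> * Z n \<omega> \<le> - (?h * ?y + \<eta> * \<delta>) + (\<theta> + ?h) * Z n \<omega>"
        by (simp add: algebra_simps)
    qed measurable
    also have "\<dots> \<le> ennreal (exp (real n * (L \<theta> - \<kappa>)))"
      using elim by (intro ennreal_leI) (auto intro!: mult_left_mono)
    finally show ?case .
  qed
  with k(1) show ?thesis by blast
qed

text \<open>Both tails of the tilted integral are exponentially smaller than the whole, so the ball
  carries enough of it. On the ball the integrand is at most \<open>exp (n * (\<theta> * deriv L
  \<theta> + \<bar>\<theta>\<bar> * \<delta>))\<close>, which converts this mass into a lower bound
  for the probability.\<close>

lemma eventually_ball:
  assumes th: "\<theta> \<in> U" and d: "\<delta> > 0" and e: "\<epsilon> > 0"
  shows "eventually (\<lambda>n. exp (- (real n * (\<theta> * deriv L \<theta> - L \<theta> + \<bar>\<theta>\<bar> * \<delta> + \<epsilon>)))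
    \<le> prob {\<omega> \<in> space M. \<bar>Z n \<omega> - deriv L \<theta>\<bar> < \<delta>}) sequentially"
proof -
  let ?y = "deriv L \<theta>"
  let ?T = "\<lambda>\<sigma> n. \<integral>\<^sup>+ \<omega>\<in>{\<omega> \<in> space M. \<delta> \<le> \<sigma> * (Z n \<omega> - ?y)}. ennreal (exp (real n * \<theta> * Z n \<omega>)) \<partial>M"
  obtain k1 k2 where k: "k1 > 0" "k2 > 0"
    and ev1: "eventually (\<lambda>n. ?T 1 n \<le> ennreal (exp (real n * (L \<theta> - k1)))) sequentially"
    and ev2: "eventually (\<lambda>n. ?T (-1) n \<le> ennreal (exp (real n * (L \<theta> - k2)))) sequentially"
    using eventually_tail[OF th d, of 1] eventually_tail[OF th d, of "-1"] by auto
  \<comment> \<open>One exponent serves both tails; \<open>k \<le> \<epsilon>\<close> keeps the part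
    left for the ball above \<open>exp (n * (L \<theta> - \<epsilon>))\<close>.\<close>
  define k where "k = min \<epsilon> (min k1 k2)"
  have k_pos: "k > 0" "k \<le> k1" "k \<le> k2" "k \<le> \<epsilon>"
    using k e by (auto simp: k_def)
  have ev3: "eventually (\<lambda>n. L \<theta> - k / 2 < K n \<theta>) sequentially"
    by (rule order_tendstoD[OF K_tendsto[OF th]]) (use k_pos in simp)
  have "filterlim (\<lambda>n. exp (real n * (k / 2))) at_top sequentially"
    using k_pos
    by (intro filterlim_compose[OF exp_at_top] filterlim_at_top_mult_tendsto_pos[OF tendsto_const]
      filterlim_real_sequentially) simp
  \<comment> \<open>The whole integral is at least three times the tail bound: two shares pay for
    the tails and one remains for the ball.\<close>
  then have ev4: "eventually (\<lambda>n. 3 \<le> exp (real n * (k / 2))) sequentially"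
    by (simp add: filterlim_at_top)
  show ?thesis
    using ev1 ev2 ev3 ev4 eventually_ge_at_top[of 1]
  proof eventually_elim
    case (elim n)
    have [measurable]: "Z n \<in> borel_measurable M"
      using Z_measurable elim by auto
    let ?B = "{\<omega> \<in> space M. \<bar>Z n \<omega> - ?y\<bar> < \<delta>}"
    let ?f = "\<lambda>\<omega>. ennreal (exp (real n * \<theta> * Z n \<omega>))"
    let ?A = "\<lambda>\<sigma>. {\<omega> \<in> space M. \<delta> \<le> \<sigma> * (Z n \<omega> - ?y)}"
    let ?c = "real n * (\<theta> * ?y + \<bar>\<theta>\<bar> * \<delta>)"
    let ?x = "exp (real n * (L \<theta> - k))"
    have "ennreal (exp (real n * K n \<theta>)) = (\<integral>\<^sup>+ \<omega>. ?f \<omega> \<partial>M)"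
      using mgf elim th by simp
    also have "\<dots> \<le> (\<integral>\<^sup>+ \<omega>. ennreal (exp ?c) * indicator ?B \<omega> +
        (?f \<omega> * indicator (?A 1) \<omega> + ?f \<omega> * indicator (?A (-1)) \<omega>) \<partial>M)"
    proof (rule nn_integral_mono)
      fix \<omega> assume om: "\<omega> \<in> space M"
      show "?f \<omega> \<le> ennreal (exp ?c) * indicator ?B \<omega> +
        (?f \<omega> * indicator (?A 1) \<omega> + ?f \<omega> * indicator (?A (-1)) \<omega>)"
      proof (cases "\<bar>Z n \<omega> - ?y\<bar> < \<delta>")
        case True
        have "\<theta> * (Z n \<omega> - ?y) \<le> \<bar>\<theta>\<bar> * \<bar>Z n \<omega> - ?y\<bar>"
          by (metis abs_ge_self abs_mult)
        also have "\<dots> \<le> \<bar>\<theta>\<bar> * \<delta>"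
          using True by (intro mult_left_mono) auto
        finally have "real n * (\<theta> * Z n \<omega>) \<le> ?c"
          by (intro mult_left_mono) (auto simp: algebra_simps)
        then show ?thesis
          using True om by (auto simp: mult.assoc intro!: add_increasing2 ennreal_leI)
      next
        case False
        then consider "\<omega> \<in> ?A 1" | "\<omega> \<in> ?A (-1)"
          using om by fastforce
        then show ?thesis
          by cases (simp_all only: indicator_simps, auto intro: add_increasing add_increasing2)
      qed
    qed
    also have "\<dots> = ennreal (exp ?c) * ennreal (prob ?B) + (?T 1 n + ?T (-1) n)"
      by (subst nn_integral_add, measurable, subst nn_integral_add, measurable)
        (simp add: nn_integral_cmult_indicator emeasure_eq_measure)
    also have "\<dots> \<le> ennreal (exp ?c) * ennreal (prob ?B) + (ennreal ?x + ennreal ?x)"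
    proof (intro add_left_mono add_mono)
      show "?T 1 n \<le> ennreal ?x"
        using elim(1) by (rule order_trans) (use k_pos in \<open>auto intro!: ennreal_leI mult_left_mono\<close>)
      show "?T (-1) n \<le> ennreal ?x"
        using elim(2) by (rule order_trans) (use k_pos in \<open>auto intro!: ennreal_leI mult_left_mono\<close>)
    qed
    also have "\<dots> = ennreal (exp ?c * prob ?B + (?x + ?x))"
      by (subst ennreal_plus, simp, simp, subst ennreal_plus, simp, simp)
        (simp only: ennreal_mult exp_ge_zero measure_nonneg)
    finally have 1: "exp (real n * K n \<theta>) \<le> exp ?c * prob ?B + (?x + ?x)"
      by (subst (asm) ennreal_le_iff) (auto intro!: add_nonneg_nonneg)
    have "3 * ?x \<le> exp (real n * (k / 2)) * ?x"
      using elim(4) by (intro mult_right_mono) auto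
    also have "\<dots> = exp (real n * (L \<theta> - k / 2))"
      by (simp add: exp_add[symmetric] algebra_simps)
    also have "\<dots> \<le> exp (real n * K n \<theta>)"
      using elim(3) by (auto intro!: mult_left_mono)
    finally have "?x \<le> exp ?c * prob ?B"
      using 1 by linarith
    moreover have "exp (real n * (L \<theta> - \<epsilon>)) \<le> ?x"
      using k_pos by (auto intro!: mult_left_mono)
    ultimately have "exp (real n * (L \<theta> - \<epsilon>)) \<le> exp ?c * prob ?B"
      by linarith
    then have "exp (- ?c) * exp (real n * (L \<theta> - \<epsilon>)) \<le> exp (- ?c) * (exp ?c * prob ?B)"
      by (rule mult_left_mono) simp
    also have "\<dots> = prob ?B"
      by (simp add: exp_minus)
    finally show ?case
      by (simp add: exp_add[symmetric] algebra_simps)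
  qed
qed

section \<open>Slopes and steepness\<close>

lemma deriv_mono:
  assumes "\<theta> \<in> U" "\<eta> \<in> U" "\<theta> \<le> \<eta>"
  shows "deriv L \<theta> \<le> deriv L \<eta>"
proof (cases "\<theta> = \<eta>")
  case False
  have "(deriv L \<theta> - deriv L \<eta>) * (\<eta> - \<theta>) \<le> 0"
    using L_tangent[OF assms(1,2)] L_tangent[OF assms(2,1)] by (simp add: algebra_simps)
  then show ?thesis
    using False assms(3) by (auto simp: mult_le_0_iff)
qed simp

text \<open>At a finite end b of U in direction \<sigma>, steepness would make the slopes unbounded.
  But in that direction \<open>\<sigma> * deriv L\<close> is bounded below by its value at 0, by
  monotonicity, and above by \<open>\<sigma> * y\<close>.\<close>

lemma half_line_subset:
  assumes sg: "\<sigma> = 1 \<or> \<sigma> = -1" and lt: "\<And>\<theta>. \<theta> \<in> U \<Longrightarrow> \<sigma> * deriv L \<theta> < \<sigma> * y"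
    and t: "t \<ge> 0"
  shows "\<sigma> * t \<in> U"
proof (rule ccontr)
  assume out: "\<sigma> * t \<notin> U"
  have "closed_segment 0 (\<sigma> * t) \<inter> frontier U \<noteq> {}"
    by (rule connected_Int_frontier[OF connected_segment])
      (use out zero_U in \<open>auto intro: ends_in_segment\<close>)
  then obtain b where b: "b \<in> closed_segment 0 (\<sigma> * t)" "b \<in> frontier U"
    by auto
  have b_sg: "\<sigma> * b \<ge> 0"
    using b(1) t sg by (auto simp: closed_segment_eq_real_ivl split: if_splits)
  have b_out: "b \<notin> U"
    using b(2) open_U by (simp add: frontier_def interior_open)
  \<comment> \<open>These points run from 0 towards b along the segment; they lie in U because 0 is
    interior and b is in the closure of the convex set U.\<close>
  define s where "s n = b - inverse (real (Suc n)) * (b - 0)" for n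
  have sU: "s n \<in> U" for n
  proof -
    have "b - inverse (real (Suc n)) *\<^sub>R (b - 0) \<in> interior U"
      by (rule mem_interior_closure_convex_shrink[OF convex_U])
        (use zero_U open_U b(2) in \<open>auto simp: frontier_def interior_open field_simps\<close>)
    then show ?thesis
      using open_U by (simp add: s_def interior_open)
  qed
  have "s \<longlonglongrightarrow> b - 0 * (b - 0)"
    unfolding s_def by (intro tendsto_intros LIMSEQ_inverse_real_of_nat)
  then have "filterlim (\<lambda>n. \<bar>deriv L (s n)\<bar>) at_top sequentially"
    using steep[OF sU b_out] by simp
  then have "eventually (\<lambda>n. \<bar>y\<bar> + \<bar>deriv L 0\<bar> + 1 \<le> \<bar>deriv L (s n)\<bar>) sequentially"
    by (simp add: filterlim_at_top)
  then obtain n where n: "\<bar>y\<bar> + \<bar>deriv L 0\<bar> + 1 \<le> \<bar>deriv L (s n)\<bar>"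
    by (auto simp: eventually_sequentially)
  have "s n = (1 - inverse (real (Suc n))) * b"
    by (simp add: s_def algebra_simps)
  then have "\<sigma> * s n = (1 - inverse (real (Suc n))) * (\<sigma> * b)"
    by simp
  also have "\<dots> \<ge> 0"
    using b_sg by (intro mult_nonneg_nonneg[of "1 - inverse (real (Suc n))" "\<sigma> * b"]) (simp_all add: field_simps)
  finally have "\<sigma> * s n \<ge> 0" .
  then have "\<sigma> * deriv L 0 \<le> \<sigma> * deriv L (s n)"
    using sg deriv_mono[OF zero_U sU, of n] deriv_mono[OF sU zero_U, of n] by auto
  with lt[OF sU, of n] n sg show False
    by auto
qed

text \<open>Far out on the half-line the slope must be close to y: if it stayed \<epsilon> below,
  the tangent at \<theta> evaluated at 0 would give
  \<open>\<theta> * y - L \<theta> \<ge> t * \<epsilon>\<close>, exceeding the rate q. Since the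
  slope stays on the inner side of y, \<open>\<theta> * deriv L \<theta> \<le> \<theta> * y\<close>,
  which yields the second claim.\<close>

lemma approx_unattained_slope:
  assumes sg: "\<sigma> = 1 \<or> \<sigma> = -1" and lt: "\<And>\<theta>. \<theta> \<in> U \<Longrightarrow> \<sigma> * deriv L \<theta> < \<sigma> * y"
    and q: "rate y = ereal q" and e: "\<epsilon> > 0"
  shows "\<exists>\<theta>\<in>U. \<bar>deriv L \<theta> - y\<bar> < \<epsilon> \<and> \<theta> * deriv L \<theta> - L \<theta> \<le> q"
proof -
  have q_ge: "\<theta> * y - L \<theta> \<le> q" if "\<theta> \<in> U" for \<theta>
    using rate_upper[OF that, of y] q by simp
  have "q \<ge> 0"
    using q_ge[OF zero_U] L_zero by simp
  \<comment> \<open>Chosen so that \<open>t * \<epsilon> = q + \<epsilon> > q\<close>.\<close>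
  define t where "t = q / \<epsilon> + 1"
  have t: "t > 0"
    using \<open>q \<ge> 0\<close> e by (simp add: t_def add_nonneg_pos)
  let ?\<theta> = "\<sigma> * t"
  have U: "?\<theta> \<in> U"
    using half_line_subset[OF sg lt] t by simp
  have "\<sigma> * y - \<epsilon> < \<sigma> * deriv L ?\<theta>"
  proof (rule ccontr)
    assume "\<not> ?thesis"
    then have "t * (\<sigma> * deriv L ?\<theta>) \<le> t * (\<sigma> * y - \<epsilon>)"
      using t by (intro mult_left_mono) auto
    moreover have "L ?\<theta> \<le> t * (\<sigma> * deriv L ?\<theta>)"
      using L_tangent[OF U zero_U] L_zero by (simp add: algebra_simps)
    ultimately have "t * \<epsilon> \<le> q"
      using q_ge[OF U] by (simp add: algebra_simps)
    moreover have "t * \<epsilon> = q + \<epsilon>"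
      using e by (simp add: t_def distrib_right)
    ultimately show False
      using e by simp
  qed
  with lt[OF U] sg have "\<bar>deriv L ?\<theta> - y\<bar> < \<epsilon>"
    by auto
  moreover have "t * (\<sigma> * deriv L ?\<theta>) \<le> t * (\<sigma> * y)"
    using lt[OF U] t by (metis less_imp_le mult_left_mono)
  then have "?\<theta> * deriv L ?\<theta> - L ?\<theta> \<le> q"
    using q_ge[OF U] by (simp add: algebra_simps)
  ultimately show ?thesis
    using U by blast
qed

text \<open>Darboux's argument: L minus the line of slope y decreases to the right of a and
  increases into b, so its minimum over \<open>{a..b}\<close> is interior.\<close>

lemma deriv_intermediate:
  assumes a: "a \<in> U" "deriv L a < y" and b: "b \<in> U" "y < deriv L b"
  shows "\<exists>\<theta>\<in>U. deriv L \<theta> = y"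
proof -
  have "a < b"
    using deriv_mono[OF b(1) a(1)] a b by force
  have sub: "{a..b} \<subseteq> U"
    using convex_contains_segment[of U] convex_U a b \<open>a < b\<close>
    by (metis closed_segment_eq_real_ivl less_imp_le)
  let ?f = "\<lambda>\<theta>. L \<theta> - y * \<theta>"
  have f': "(?f has_real_derivative deriv L \<theta> - y) (at \<theta>)" if "\<theta> \<in> U" for \<theta>
    by (auto intro!: derivative_eq_intros L_deriv that)
  have "continuous_on {a..b} ?f"
    using f' sub by (intro continuous_at_imp_continuous_on) (auto intro: DERIV_isCont)
  then obtain c where c: "c \<in> {a..b}" "\<And>x. x \<in> {a..b} \<Longrightarrow> ?f c \<le> ?f x"
    using continuous_attains_inf[of "{a..b}" ?f] \<open>a < b\<close> by auto
  obtain d where d: "d > 0" "\<And>h. h > 0 \<Longrightarrow> h < d \<Longrightarrow> ?f (a + h) < ?f a"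
    using DERIV_neg_dec_right[OF f'[OF a(1)]] a(2) by auto
  have "c \<noteq> a"
  proof
    assume "c = a"
    let ?h = "min (d / 2) (b - a)"
    have "?f (a + ?h) < ?f a" using d \<open>a < b\<close> by (intro d(2)) auto
    moreover have "?f a \<le> ?f (a + ?h)" using c(2)[of "a + ?h"] \<open>c = a\<close> d(1) \<open>a < b\<close> by auto
    ultimately show False by simp
  qed
  obtain d' where d': "d' > 0" "\<And>h. h > 0 \<Longrightarrow> h < d' \<Longrightarrow> ?f (b - h) < ?f b"
    using DERIV_pos_inc_left[OF f'[OF b(1)]] b(2) by auto
  have "c \<noteq> b"
  proof
    assume "c = b"
    let ?h = "min (d' / 2) (b - a)"
    have "?f (b - ?h) < ?f b" using d' \<open>a < b\<close> by (intro d'(2)) auto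
    moreover have "?f b \<le> ?f (b - ?h)" using c(2)[of "b - ?h"] \<open>c = b\<close> d'(1) \<open>a < b\<close> by auto
    ultimately show False by simp
  qed
  then have "a < c" "c < b" using c(1) \<open>c \<noteq> a\<close> by auto
  have "c \<in> U" using c(1) sub by auto
  have "deriv L c - y = 0"
  proof (rule DERIV_local_min[OF f'[OF \<open>c \<in> U\<close>]])
    show "0 < min (c - a) (b - c)" using \<open>a < c\<close> \<open>c < b\<close> by simp
    show "\<forall>x. \<bar>c - x\<bar> < min (c - a) (b - c) \<longrightarrow> ?f c \<le> ?f x"
      using c(2) by (auto simp: abs_less_iff)
  qed
  then show ?thesis using \<open>c \<in> U\<close> by auto
qed

text \<open>Lets a nearby slope, around which \<open>eventually_ball\<close> applies, stand in for y
  at no higher cost. A slope y that is not attained lies on one side of all slopes by the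
  intermediate value property.\<close>

lemma approx_slope:
  assumes q: "rate y = ereal q" and e: "\<epsilon> > 0"
  shows "\<exists>\<theta>\<in>U. \<bar>deriv L \<theta> - y\<bar> < \<epsilon> \<and> \<theta> * deriv L \<theta> - L \<theta> \<le> q"
proof (cases "\<exists>\<theta>\<in>U. deriv L \<theta> = y")
  case True
  then obtain \<theta> where "\<theta> \<in> U" "deriv L \<theta> = y" by auto
  then show ?thesis
    using rate_upper[of \<theta> y] q e by (intro bexI[of _ \<theta>]) auto
next
  case False
  then consider "\<And>\<theta>. \<theta> \<in> U \<Longrightarrow> 1 * deriv L \<theta> < 1 * y" | "\<And>\<theta>. \<theta> \<in> U \<Longrightarrow> -1 * deriv L \<theta> < -1 * y"
    using deriv_intermediate[of _ y] by fastforce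
  then show ?thesis
    using approx_unattained_slope[OF _ _ q e, of 1] approx_unattained_slope[OF _ _ q e, of "-1"]
    by cases blast+
qed

section \<open>Lower bound for open sets\<close>

lemma lower_bound:
  assumes "open G"
  shows "- (INF x\<in>G. rate x)
    \<le> liminf (\<lambda>n. ereal (1 / real n) * log_prob (prob {\<omega> \<in> space M. Z n \<omega> \<in> G}))"
proof -
  let ?lp = "\<lambda>n. ereal (1 / real n) * log_prob (prob {\<omega> \<in> space M. Z n \<omega> \<in> G})"
  have main: "ereal (- q - e) \<le> liminf ?lp" if y: "y \<in> G" "rate y = ereal q" and e: "e > 0" for y q e
  proof -
    obtain r where r: "r > 0" "ball y r \<subseteq> G"
      using assms y(1) open_contains_ball by blast
    obtain \<theta> where th: "\<theta> \<in> U" "\<bar>deriv L \<theta> - y\<bar> < r / 2" "\<theta> * deriv L \<theta> - L \<theta> \<le> q"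
      using approx_slope[OF y(2), of "r / 2"] r(1) by auto
    \<comment> \<open>The first bound keeps the \<delta>-ball around the slope inside
      \<open>ball y r\<close>; the second makes the tilting cost
      \<open>\<bar>\<theta>\<bar> * \<delta>\<close> at most \<open>e / 2\<close>, with the added 1
      covering \<theta> = 0.\<close>
    define \<delta> where "\<delta> = min (r / 2) (e / 2 / (\<bar>\<theta>\<bar> + 1))"
    have d: "\<delta> > 0" "\<delta> \<le> r / 2"
      using r(1) e unfolding \<delta>_def by (simp_all del: divide_divide_eq_left)
    have "\<bar>\<theta>\<bar> * \<delta> \<le> (\<bar>\<theta>\<bar> + 1) * (e / 2 / (\<bar>\<theta>\<bar> + 1))"
      using e d by (intro mult_mono) (auto simp: \<delta>_def)
    also have "\<dots> = e / 2"
      by (simp del: divide_divide_eq_left)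
    finally have d3: "\<bar>\<theta>\<bar> * \<delta> \<le> e / 2" .
    have "eventually (\<lambda>n. ereal (- q - e) \<le> ?lp n) sequentially"
      using eventually_ball[OF th(1) d(1), of "e / 2", simplified, OF e] eventually_ge_at_top[of 1]
    proof eventually_elim
      case (elim n)
      have [measurable]: "Z n \<in> borel_measurable M" "G \<in> sets borel"
        using Z_measurable elim assms by auto
      have "exp (- (real n * (q + e))) \<le> exp (- (real n * (\<theta> * deriv L \<theta> - L \<theta> + \<bar>\<theta>\<bar> * \<delta> + e / 2)))"
        using th(3) d3 by (auto intro!: mult_left_mono)
      also have "\<dots> \<le> prob {\<omega> \<in> space M. \<bar>Z n \<omega> - deriv L \<theta>\<bar> < \<delta>}"
        using elim by simp
      also have "\<dots> \<le> prob {\<omega> \<in> space M. Z n \<omega> \<in> G}"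
      proof (rule finite_measure_mono)
        show "{\<omega> \<in> space M. \<bar>Z n \<omega> - deriv L \<theta>\<bar> < \<delta>} \<subseteq> {\<omega> \<in> space M. Z n \<omega> \<in> G}"
        proof
          fix \<omega> assume "\<omega> \<in> {\<omega> \<in> space M. \<bar>Z n \<omega> - deriv L \<theta>\<bar> < \<delta>}"
          moreover from this have "Z n \<omega> \<in> ball y r"
            using th(2) d(2) unfolding mem_ball dist_real_def mem_Collect_eq by linarith
          ultimately show "\<omega> \<in> {\<omega> \<in> space M. Z n \<omega> \<in> G}"
            using r(2) by auto
        qed
      qed measurable
      finally have *: "exp (- (real n * (q + e))) \<le> prob {\<omega> \<in> space M. Z n \<omega> \<in> G}" .
      then have pos: "prob {\<omega> \<in> space M. Z n \<omega> \<in> G} > 0"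
        using exp_gt_zero less_le_trans by blast
      then have "- (real n * (q + e)) \<le> ln (prob {\<omega> \<in> space M. Z n \<omega> \<in> G})"
        using * by (simp add: ln_ge_iff)
      then show ?case
        using pos elim by (simp add: log_prob_def field_simps)
    qed
    then show ?thesis
      by (rule Liminf_bounded)
  qed
  have "- rate y \<le> liminf ?lp" if y: "y \<in> G" for y
  proof (cases "rate y")
    case (real q)
    have "ereal (- q) \<le> x + ereal e" if "ereal (- q - e) \<le> x" for e and x :: ereal
      using that by (cases x) auto
    from this[OF main[OF y real]] have "ereal (- q) \<le> liminf ?lp"
      by (rule ereal_le_epsilon2)
    then show ?thesis using real by simp
  qed (use rate_nonneg[of y] in auto)
  then have "- liminf ?lp \<le> rate y" if "y \<in> G" for y
    using that ereal_uminus_le_reorder by blast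
  then have "- liminf ?lp \<le> (INF x\<in>G. rate x)"
    by (rule INF_greatest)
  then show ?thesis
    using ereal_uminus_le_reorder by blast
qed

theorem gaertner_ellis: "LDP M Z real rate \<and> good_rate rate"
  unfolding LDP_def
  using Z_measurable rate_nonneg rate_lsc upper_bound lower_bound rate_good filterlim_real_sequentially
  by blast

end

section \<open>Large deviations of \<open>C\<^sub>n(w)\<close>\<close>

lemma h_fun_continuous_on: "continuous_on {0..1} w \<Longrightarrow> continuous_on {0..<1} (h_fun w)"
  unfolding h_fun_def[abs_def]
  by (intro continuous_intros) (auto elim: continuous_on_subset)

text \<open>Within x0 of the endpoint the growth condition gives c; elsewhere the denominator is at
  least x0, which gives \<open>W / x0\<close>.\<close>

lemma h_fun_bounded:
  assumes cont: "continuous_on {0..1} w"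
    and tail: "0 < x0" "0 < c" "\<And>x. x \<in> {1 - x0..1} \<Longrightarrow> \<bar>w x\<bar> \<le> c * (1 - x)"
  shows "\<exists>B>0. \<forall>x\<in>{0..<1}. \<bar>h_fun w x\<bar> \<le> B"
proof -
  have "bounded (w ` {0..1})"
    using cont by (intro compact_imp_bounded compact_continuous_image) auto
  then obtain W where "\<forall>y\<in>w ` {0..1}. norm y \<le> W"
    unfolding bounded_iff by blast
  then have W: "\<bar>w x\<bar> \<le> W" if "x \<in> {0..1}" for x
    using that by simp
  have "0 \<le> W" using W[of 0] by simp
  have "\<bar>h_fun w x\<bar> \<le> c + W / x0" if x: "x \<in> {0..<1}" for x
  proof (cases "1 - x0 \<le> x")
    case True
    then have "\<bar>h_fun w x\<bar> \<le> c"
      using tail(3)[of x] x by (simp add: h_fun_def abs_divide divide_le_eq)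
    then show ?thesis
      using \<open>0 \<le> W\<close> tail(1) by (intro add_increasing2) auto
  next
    case False
    then have "\<bar>w x\<bar> / (1 - x) \<le> W / x0"
      using W[of x] x tail(1) \<open>0 \<le> W\<close> by (intro frac_le) auto
    then show ?thesis
      using x tail(2) by (simp add: h_fun_def abs_divide)
  qed
  moreover have "c + W / x0 > 0"
    using \<open>0 \<le> W\<close> tail by (intro add_pos_nonneg) auto
  ultimately show ?thesis by blast
qed

context bounded_weight
begin

lemma cumulant_limit_C_stat:
  assumes M: "prob_space M"
    and indep: "prob_space.indep_vars M (\<lambda>_. borel) X {1..}"
    and distr: "\<And>n. n \<ge> 1 \<Longrightarrow> distributed M lborel (X n) (exponential_density lam)"
    and smooth: "essentially_smooth (Lambda lam w)"
  shows "cumulant_limit M (C_stat w X) (\<lambda>n \<theta>. (\<Sum>k<n. lr \<theta> (real k / real n)) / real n) L U"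
proof -
  interpret prob_space M by (rule M)
  show ?thesis
  proof
    fix n :: nat assume n: "n \<ge> 1"
    have X: "X i \<in> borel_measurable M" if "i \<in> {1..n}" for i
      using distr[of i] that by (auto dest: distributed_measurable)
    show "C_stat w X n \<in> borel_measurable M"
      unfolding C_stat_eq_gap_sum[abs_def]
      by (rule measurable_gap_sum) (use X in auto)
    fix \<theta> assume th: "\<theta> \<in> U"
    have less: "\<theta> * h (real k / real n) < lam" if "k < n" for k
      by (rule U_less[OF th]) (use that in auto)
    have "(\<integral>\<^sup>+ \<omega>. ennreal (exp (real n * \<theta> * C_stat w X n \<omega>)) \<partial>M)
      = ennreal (\<Prod>k<n. lam / (lam - \<theta> * h (real k / real n)))"
      by (rule mgf_C_stat[OF lam_pos indep distr n less])
    also have "(\<Prod>k<n. lam / (lam - \<theta> * h (real k / real n))) = exp (\<Sum>k<n. lr \<theta> (real k / real n))"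
      unfolding exp_sum[OF finite_lessThan] log_ratio_def
      by (intro prod.cong refl exp_ln[symmetric]) (use less lam_pos in simp)
    finally show "(\<integral>\<^sup>+ \<omega>. ennreal (exp (real n * \<theta> * C_stat w X n \<omega>)) \<partial>M)
      = ennreal (exp (real n * ((\<Sum>k<n. lr \<theta> (real k / real n)) / real n)))"
      using n by simp
  next
    fix \<theta> assume th: "\<theta> \<in> U"
    obtain C where "\<And>x. x \<in> {0..<1} \<Longrightarrow> \<bar>lr \<theta> x\<bar> \<le> C"
      using lr_bounded[OF th] by blast
    then show "(\<lambda>n. (\<Sum>k<n. lr \<theta> (real k / real n)) / real n) \<longlonglongrightarrow> L \<theta>"
      unfolding L_eq[OF th] by (rule riemann_sums_tendsto[OF lr_cont[OF th]])
    show "L differentiable (at \<theta>)"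
      using smooth th unfolding essentially_smooth_def interior_eff_domain L_def[abs_def] by blast
  next
    fix s :: "nat \<Rightarrow> real" and b
    assume s: "\<And>n. s n \<in> U" and b: "b \<notin> U" and lim: "s \<longlonglongrightarrow> b"
    \<comment> \<open>The point b may itself belong to the effective domain. It is a frontier point
      because it lies in the closure of the domain but outside its interior U.\<close>
    have "b \<in> closure U"
      using s lim unfolding closure_sequential by blast
    also have "\<dots> \<subseteq> closure (eff_domain (Lambda lam w))"
      using interior_eff_domain interior_subset by (metis closure_mono)
    finally have "b \<in> frontier (eff_domain (Lambda lam w))"
      using b by (simp add: frontier_def interior_eff_domain)
    then show "filterlim (\<lambda>n. \<bar>deriv L (s n)\<bar>) at_top sequentially"
      using smooth s lim unfolding essentially_smooth_def interior_eff_domain L_def[abs_def] by blast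
  qed (rule U_open U_convex zero_mem_U L_convex)+
qed

text \<open>Boundary points of the effective domain contribute nothing to the Legendre transform, because
  convexity of the integrand bounds \<open>\<Lambda>(t \<theta>)\<close> by \<open>t \<Lambda>(\<theta>)\<close> as \<open>t\<close> increases to 1.\<close>

lemma legendre_transform_Lambda:
  "legendre_transform (Lambda lam w) y = (SUP \<theta>\<in>U. ereal (\<theta> * y - L \<theta>))"
proof (rule antisym)
  show "(SUP \<theta>\<in>U. ereal (\<theta> * y - L \<theta>)) \<le> legendre_transform (Lambda lam w) y"
    unfolding legendre_transform_def
  proof (rule SUP_least)
    fix \<theta> assume "\<theta> \<in> U"
    then have "ereal (\<theta> * y - L \<theta>) = ereal (\<theta> * y) - Lambda lam w \<theta>"
      by (simp add: Lambda_eq_L)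
    then show "ereal (\<theta> * y - L \<theta>) \<le> (SUP \<theta>. ereal (\<theta> * y) - Lambda lam w \<theta>)"
      by (intro SUP_upper2[of \<theta>]) simp_all
  qed
  show "legendre_transform (Lambda lam w) y \<le> (SUP \<theta>\<in>U. ereal (\<theta> * y - L \<theta>))"
    unfolding legendre_transform_def
  proof (rule SUP_least)
    fix \<theta> :: real
    let ?R = "SUP \<theta>\<in>U. ereal (\<theta> * y - L \<theta>)"
    show "ereal (\<theta> * y) - Lambda lam w \<theta> \<le> ?R"
    proof (cases "\<theta> \<in> eff_domain (Lambda lam w)")
      case False
      then show ?thesis by (simp add: eff_domain_def)
    next
      case True
      have le: "ereal (L (t * \<theta>)) \<le> ereal t * Lambda lam w \<theta>" if "0 < t" "t < 1" for t
        using Lambda_shrink_le[OF True that] Lambda_eq_L[OF shrink_mem_U[OF True that]] by simp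
      \<comment> \<open>The value \<open>-\<infinity>\<close> is excluded because half of it would
        have to bound the real number \<open>L (\<theta> / 2)\<close> from above.\<close>
      obtain l where l: "Lambda lam w \<theta> = ereal l"
        using True le[of "1 / 2"] by (cases "Lambda lam w \<theta>") (auto simp: eff_domain_def)
      have step: "ereal (t * (\<theta> * y - l)) \<le> ?R" if t: "0 < t" "t < 1" for t
      proof -
        have "ereal (t * (\<theta> * y - l)) \<le> ereal (t * \<theta> * y - L (t * \<theta>))"
          using le[OF t] l by (simp add: algebra_simps)
        also have "\<dots> \<le> ?R"
          using shrink_mem_U[OF True t] by (rule SUP_upper)
        finally show ?thesis .
      qed
      have "ereal (\<theta> * y - l) \<le> ?R"
      proof (cases ?R)
        case (real r)
        have "\<theta> * y - l \<le> r"
          by (rule field_le_mult_one_interval) (use step real in simp)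
        with real show ?thesis by simp
      next
        case MInf
        then show ?thesis using step[of "1 / 2"] by simp
      qed simp
      with l show ?thesis by simp
    qed
  qed
qed

end

theorem proposition3p1:
  fixes M :: "'a measure" and X :: "nat \<Rightarrow> 'a \<Rightarrow> real"
    and lam :: real and w :: "real \<Rightarrow> real"
  assumes "prob_space M"
    and "0 < lam"
    and "prob_space.indep_vars M (\<lambda>_. borel) X {1..}"
    and "\<And>n. n \<ge> 1 \<Longrightarrow> distributed M lborel (X n) (exponential_density lam)"
    and "continuous_on {0..1} w"
    and "\<exists>x0 c. 0 < x0 \<and> x0 < 1 \<and> 0 < c \<and> (\<forall>x\<in>{1 - x0..1}. \<bar>w x\<bar> \<le> c * (1 - x))"
    and "\<forall>\<^sub>F \<theta> in nhds 0. \<bar>Lambda lam w \<theta>\<bar> \<noteq> \<infinity>"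
    and "essentially_smooth (Lambda lam w)"
    and "lower_semicontinuous (Lambda lam w)"
  shows "LDP M (C_stat w X) (\<lambda>n. real n) (legendre_transform (Lambda lam w)) \<and>
    good_rate (legendre_transform (Lambda lam w))"
proof -
  obtain x0 c where "0 < x0" "0 < c" "\<And>x. x \<in> {1 - x0..1} \<Longrightarrow> \<bar>w x\<bar> \<le> c * (1 - x)"
    using assms(6) by blast
  then obtain B where B: "0 < B" "\<forall>x\<in>{0..<1}. \<bar>h_fun w x\<bar> \<le> B"
    using h_fun_bounded[OF assms(5)] by blast
  interpret bounded_weight lam w B
    using assms(2) B h_fun_continuous_on[OF assms(5)] by unfold_locales auto
  interpret cumulant_limit M "C_stat w X" "\<lambda>n \<theta>. (\<Sum>k<n. lr \<theta> (real k / real n)) / real n" L U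
    using assms(1,3,4,8) by (rule cumulant_limit_C_stat)
  have "legendre_transform (Lambda lam w) = rate"
    by (simp add: fun_eq_iff legendre_transform_Lambda rate_def)
  with gaertner_ellis show ?thesis
    by simp
qed

end
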